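(* Let $d\ge1$, let $(X_t)_{t\ge0}$ be continuous-time simple random walk on $\mathbb{Z}^d$ started at $0$, and let $T\mapsto\alpha_T\in(0,\infty)$ satisfy $$1\ll\alpha_T\ll\Big(\frac{T}{\log T}\Big)^{1/(d+2)}\qquad\text{as }T\to\infty.$$ Fix $R>0$, denote $Q_R=[-R,R]^d$ and fix a measurable function $F:M_1(Q_R)\to\mathbb{R}$. Introduce $$\chi=\inf\Big\{\tfrac12\|\nabla g\|_2^2-F(g^2)\;:\;g\in H^1(\mathbb{R}^d),\ \|g\|_2=1,\ \mathrm{supp}(g)\subseteq Q_R\Big\}.$$ Then $$\limsup_{T\to\infty}\frac{\alpha_T^2}{T}\log\mathbb{E}_0\Big[\exp\Big\{\frac{T}{\alpha_T^2}F(L_T)\Big\}\mathbb{1}_{\{\mathrm{supp}(L_T)\subseteq Q_R\}}\Big]\le-\chi,$$ provided that $$\liminf_{T\uparrow\infty}\ \inf_{\mu\in\mathcal{M}_1(B_{R\alpha_T})}\Big(\alpha_T^2\,\tfrac12\sum_{x\sim y}\big(\sqrt{\mu(x)}-\sqrt{\mu(y)}\big)^2-F\big(\alpha_T^d\,\mu(\lfloor\,\cdot\,\alpha_T\rfloor)\big)\Big)\ge\chi.$$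
   Context: Continuous-time simple random walk on $\mathbb{Z}^d$ has the symmetric generator $A$ with $A_{x,y}=\frac12$ if $x,y$ are nearest neighbours, $A_{x,x}=-d$, and $A_{x,y}=0$ otherwise. $\mathbb{E}_0$ is the expectation for the walk started at $0$. The notation $f_T\ll g_T$ means $f_T/g_T\to0$ as $T\to\infty$. Local times: $\ell_T(z)=\int_0^T\mathbb{1}_{\{X_s=z\}}\,ds$, $z\in\mathbb{Z}^d$. Rescaled local times: $L_T(x)=\frac{\alpha_T^d}{T}\,\ell_T(\lfloor\alpha_Tx\rfloor)$, $x\in\mathbb{R}^d$ (floor taken componentwise); $L_T$ is a random probability density on $\mathbb{R}^d$. For a cube $Q\subset\mathbb{R}^d$, $M_1(Q)$ is the set of all probability densities $Q\to[0,\infty)$ (extended by $0$ outside $Q$), with the topology induced by integration against bounded continuous test functions, and the corresponding Borel $\sigma$-algebra. $B_{R\alpha_T}=[-R\alpha_T,R\alpha_T]^d\cap\mathbb{Z}^d$. $\mathcal{M}_1(B_{R\alpha_T})$ is the set of probability measures $\mu$ on $B_{R\alpha_T}$, extended by $0$ to $\mathbb{Z}^d$, for which the rescaled density $x\mapsto\alpha_T^d\mu(\lfloor x\alpha_T\rfloor)$ is supported in $Q_R$ (so that $F$ can be applied to it). The sum $\sum_{x\sim y}$ runs over all unordered pairs of nearest neighbours in $\mathbb{Z}^d$ (including pairs with one site outside $B_{R\alpha_T}$, where $\mu=0$), so that $\frac12\sum_{x\sim y}(\sqrt{\mu(x)}-\sqrt{\mu(y)})^2=\|(-A)^{1/2}\sqrt\mu\|_2^2$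 is the Dirichlet form of $A$ at $\sqrt\mu$. *)

theory Defs
  imports "HOL-Probability.Probability"
begin

section \<open>Continuous-time simple random walk\<close>

definition nearest_neighbours :: "int ^ 'd::finite \<Rightarrow> int ^ 'd \<Rightarrow> bool" where
  "nearest_neighbours x y \<longleftrightarrow> (\<Sum>i\<in>UNIV. \<bar>x $ i - y $ i\<bar>) = 1"

definition srw_generator :: "int ^ 'd::finite \<Rightarrow> int ^ 'd \<Rightarrow> real" where
  "srw_generator x y =
     (if nearest_neighbours x y then 1/2 else if x = y then - real CARD('d) else 0)"

primrec matrix_power :: "('s \<Rightarrow> 's \<Rightarrow> real) \<Rightarrow> nat \<Rightarrow> 's \<Rightarrow> 's \<Rightarrow> real" where
  "matrix_power A 0 = (\<lambda>x y. if x = y then 1 else 0)"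
| "matrix_power A (Suc n) = (\<lambda>x y. \<Sum>\<^sub>\<infinity>z\<in>UNIV. A x z * matrix_power A n z y)"

text \<open>The entries of \<open>exp (t A)\<close>. The series converges absolutely for every matrix
  with uniformly bounded absolute row sums, in particular for \<open>srw_generator\<close>.\<close>

definition transition_prob :: "('s \<Rightarrow> 's \<Rightarrow> real) \<Rightarrow> real \<Rightarrow> 's \<Rightarrow> 's \<Rightarrow> real" where
  "transition_prob A t x y = (\<Sum>n. t ^ n / fact n * matrix_power A n x y)"

text \<open>Right-continuous Markov chain with bounded generator \<open>A\<close> and initial state \<open>a\<close>.
  The state space is discrete, so right-continuity means being constant on some interval to
  the right of every time. Only the times \<open>t \<ge> 0\<close> of \<open>X\<close> matter.\<close>

locale markov_chain = prob_space M
  for M :: "'w measure" and X :: "real \<Rightarrow> 'w \<Rightarrow> 's" and A :: "'s \<Rightarrow> 's \<Rightarrow> real" and a :: 's +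
  assumes measurable_state: "\<And>t. 0 \<le> t \<Longrightarrow> X t \<in> measurable M (count_space UNIV)"
    and right_continuous:
      "\<And>t \<omega>. 0 \<le> t \<Longrightarrow> \<omega> \<in> space M \<Longrightarrow> eventually (\<lambda>s. X s \<omega> = X t \<omega>) (at_right t)"
    and finite_dim_distributions:
      "\<And>(n::nat) t x. t 0 = 0 \<Longrightarrow> (\<And>i. i < n \<Longrightarrow> t i \<le> t (Suc i)) \<Longrightarrow>
         prob {\<omega> \<in> space M. \<forall>i\<le>n. X (t i) \<omega> = x i} =
           (if x 0 = a then 1 else 0) *
           (\<Prod>i<n. transition_prob A (t (Suc i) - t i) (x i) (x (Suc i)))"

abbreviation simple_random_walk :: "'w measure \<Rightarrow> (real \<Rightarrow> 'w \<Rightarrow> int ^ 'd::finite) \<Rightarrow> bool" where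
  "simple_random_walk M X \<equiv> markov_chain M X srw_generator 0"


section \<open>Local times\<close>

definition local_time :: "(real \<Rightarrow> 'w \<Rightarrow> 's) \<Rightarrow> real \<Rightarrow> 'w \<Rightarrow> 's \<Rightarrow> real" where
  "local_time X T \<omega> z = (LINT s:{0..T}|lborel. indicator {z} (X s \<omega>))"

definition floor_vec :: "real ^ 'd::finite \<Rightarrow> int ^ 'd" where
  "floor_vec x = (\<chi> i. \<lfloor>x $ i\<rfloor>)"

definition rescaled_local_time ::
    "(real \<Rightarrow> 'w \<Rightarrow> int ^ 'd::finite) \<Rightarrow> (real \<Rightarrow> real) \<Rightarrow> real \<Rightarrow> 'w \<Rightarrow> real ^ 'd \<Rightarrow> real" where
  "rescaled_local_time X \<alpha> T \<omega> x =
     \<alpha> T ^ CARD('d) / T * local_time X T \<omega> (floor_vec (\<alpha> T *\<^sub>R x))"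


section \<open>Probability densities on a cube\<close>

definition supp :: "('a::topological_space \<Rightarrow> real) \<Rightarrow> 'a set" where
  "supp f = closure {x. f x \<noteq> 0}"

definition cube :: "real \<Rightarrow> (real ^ 'd::finite) set" where
  "cube R = {x. \<forall>i. - R \<le> x $ i \<and> x $ i \<le> R}"

text \<open>Densities are functions rather than classes modulo null sets. Functions that agree
  almost everywhere have the same neighbourhoods in the topology below, hence a real function
  that is measurable for its Borel sigma-algebra does not distinguish them.\<close>

definition densities :: "(real ^ 'd::finite) set \<Rightarrow> (real ^ 'd \<Rightarrow> real) set" where
  "densities Q = {f. (\<forall>x. 0 \<le> f x) \<and> (\<forall>x. x \<notin> Q \<longrightarrow> f x = 0) \<and> has_bochner_integral lborel f 1}"

definition densities_topology :: "(real ^ 'd::finite) set \<Rightarrow> (real ^ 'd \<Rightarrow> real) topology" where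
  "densities_topology Q = topology_generated_by
     {{f \<in> densities Q. (LINT x:Q|lborel. f x * \<phi> x) \<in> U} | \<phi> U.
        continuous_on Q \<phi> \<and> bounded (\<phi> ` Q) \<and> open (U :: real set)}"

definition densities_borel :: "(real ^ 'd::finite) set \<Rightarrow> (real ^ 'd \<Rightarrow> real) measure" where
  "densities_borel Q = sigma (densities Q) {U. openin (densities_topology Q) U}"


section \<open>The Sobolev space \<open>H\<^sup>1\<close> and the variational formula\<close>

definition partial_derivative :: "'d::finite \<Rightarrow> (real ^ 'd \<Rightarrow> real) \<Rightarrow> real ^ 'd \<Rightarrow> real" where
  "partial_derivative i f x = frechet_derivative f (at x) (axis i 1)"

primrec cont_diff :: "nat \<Rightarrow> (real ^ 'd::finite \<Rightarrow> real) \<Rightarrow> bool" where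
  "cont_diff 0 f \<longleftrightarrow> continuous_on UNIV f"
| "cont_diff (Suc n) f \<longleftrightarrow>
     (\<forall>x. f differentiable (at x)) \<and> (\<forall>i. cont_diff n (partial_derivative i f))"

definition test_functions :: "(real ^ 'd::finite \<Rightarrow> real) set" where
  "test_functions = {\<phi>. (\<forall>n. cont_diff n \<phi>) \<and> compact (supp \<phi>)}"

definition L2 :: "(real ^ 'd::finite \<Rightarrow> 'b::euclidean_space) set" where
  "L2 = {f \<in> borel_measurable lborel. integrable lborel (\<lambda>x. (norm (f x))\<^sup>2)}"

definition is_weak_gradient :: "(real ^ 'd::finite \<Rightarrow> real) \<Rightarrow> (real ^ 'd \<Rightarrow> real ^ 'd) \<Rightarrow> bool" where
  "is_weak_gradient g G \<longleftrightarrow> G \<in> L2 \<and>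
     (\<forall>\<phi>\<in>test_functions. \<forall>i.
        (LINT x|lborel. g x * partial_derivative i \<phi> x) = - (LINT x|lborel. G x $ i * \<phi> x))"

definition H1 :: "(real ^ 'd::finite \<Rightarrow> real) set" where
  "H1 = {g \<in> L2. \<exists>G. is_weak_gradient g G}"

text \<open>Unique up to a null set for \<open>g \<in> H1\<close>.\<close>

definition weak_gradient :: "(real ^ 'd::finite \<Rightarrow> real) \<Rightarrow> real ^ 'd \<Rightarrow> real ^ 'd" where
  "weak_gradient g = (SOME G. is_weak_gradient g G)"

definition L2_norm :: "(real ^ 'd::finite \<Rightarrow> 'b::euclidean_space) \<Rightarrow> real" where
  "L2_norm f = sqrt (LINT x|lborel. (norm (f x))\<^sup>2)"

definition chi :: "real \<Rightarrow> ((real ^ 'd::finite \<Rightarrow> real) \<Rightarrow> real) \<Rightarrow> ereal" where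
  "chi R F = (INF g\<in>{g \<in> H1. L2_norm g = 1 \<and> supp g \<subseteq> cube R}.
     ereal (1/2 * (L2_norm (weak_gradient g))\<^sup>2 - F (\<lambda>x. (g x)\<^sup>2)))"


section \<open>The discrete counterpart\<close>

definition lattice_cube :: "real \<Rightarrow> (int ^ 'd::finite) set" where
  "lattice_cube r = {z. \<forall>i. - r \<le> real_of_int (z $ i) \<and> real_of_int (z $ i) \<le> r}"

definition rescaled_density :: "real \<Rightarrow> (int ^ 'd::finite \<Rightarrow> real) \<Rightarrow> real ^ 'd \<Rightarrow> real" where
  "rescaled_density a \<mu> x = a ^ CARD('d) * \<mu> (floor_vec (a *\<^sub>R x))"

definition lattice_prob_measures :: "real \<Rightarrow> real \<Rightarrow> (int ^ 'd::finite \<Rightarrow> real) set" where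
  "lattice_prob_measures R a =
     {\<mu>. (\<forall>z. 0 \<le> \<mu> z) \<and> (\<forall>z. z \<notin> lattice_cube (R * a) \<longrightarrow> \<mu> z = 0) \<and>
         (\<Sum>z\<in>lattice_cube (R * a). \<mu> z) = 1 \<and> supp (rescaled_density a \<mu>) \<subseteq> cube R}"

text \<open>A sum over unordered pairs of nearest neighbours, written as one half of the sum over
  ordered pairs.\<close>

definition sum_edges :: "(int ^ 'd::finite \<Rightarrow> int ^ 'd \<Rightarrow> real) \<Rightarrow> real" where
  "sum_edges f = 1/2 * (\<Sum>\<^sub>\<infinity>(x, y)\<in>{(x, y). nearest_neighbours x y}. f x y)"


section \<open>Extended logarithm\<close>

text \<open>Expectations of nonnegative variables may vanish or be infinite.\<close>

definition log_ennreal :: "ennreal \<Rightarrow> ereal" where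
  "log_ennreal e =
     (if e = 0 then - \<infinity> else if e = \<infinity> then \<infinity> else ereal (ln (enn2real e)))"

end

theory Submission
  imports Defs
begin

text \<open>
  Write \<open>\<nu> = \<ell>\<^sub>T / T\<close> and let \<open>I(\<nu>)\<close> be the Dirichlet form of the generator \<open>A\<close> at \<open>sqrt \<nu>\<close>.
  On the event \<open>supp L\<^sub>T \<subseteq> Q\<^sub>R\<close> the measure \<open>\<nu>\<close> is a competitor in the discrete variational problem
  and \<open>L\<^sub>T\<close> is its rescaled density. So for every real \<open>c < \<chi>\<close> and all large \<open>T\<close> the lower bound
  assumed for that problem gives \<open>F(L\<^sub>T) \<le> \<alpha>\<^sub>T\<^sup>2 I(\<nu>) - c\<close> for each path, and the expectation is at most
  \<open>exp(- c T / \<alpha>\<^sub>T\<^sup>2)\<close> times the moment \<open>E[exp(T I(\<nu>)); \<nu> lives on B]\<close>, where \<open>B\<close> is the lattice cube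
  of radius \<open>R \<alpha>\<^sub>T\<close>. It remains to see that this moment is \<open>exp(o(T / \<alpha>\<^sub>T\<^sup>2))\<close>: the large-deviation
  rate of the local times is at least the Dirichlet form, up to the entropy of a grid.

  The moment is estimated through the Feynman--Kac inequality (\<open>feynman_kac\<close>): if \<open>u \<ge> 1\<close> is
  bounded and \<open>V = - A u / u\<close>, then \<open>E[exp(\<integral>\<^sub>0\<^sup>T V(X\<^sub>s) ds) u(X\<^sub>T)] \<le> u(X\<^sub>0)\<close>. Its exponent is
  \<open>- T \<Sum>\<^sub>x \<nu>(x) A u(x) / u(x)\<close>, which is \<open>T I(\<nu>)\<close> for \<open>u = sqrt \<nu>\<close>. Since \<open>\<nu>\<close> is random, \<open>u\<close> cannot
  be chosen in this way in advance. But the exponent does not change when \<open>u\<close> is multiplied by a constant,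
  and replacing \<open>T sqrt \<nu>\<close> by its integer part plus one costs only a factor \<open>exp(2 d |B|)\<close>
  (\<open>matrix_apply_rounded_root_le\<close>). The rounded functions form a family of at most
  \<open>(T + 1)^|B|\<close> members, and summing the Feynman--Kac inequality over the family yields
  \<open>exp(2 d |B|) (T + 1)^(|B| + 1)\<close> (\<open>exp_dirichlet_form_local_times_le\<close>). As \<open>|B|\<close> is of order \<open>\<alpha>\<^sub>T\<^sup>d\<close>, its
  logarithm is of order \<open>\<alpha>\<^sub>T\<^sup>d log T\<close>, and this is \<open>o(T / \<alpha>\<^sub>T\<^sup>2)\<close> precisely when
  \<open>\<alpha>\<^sub>T \<ll> (T / log T)^(1 / (d + 2))\<close>.

  The Feynman--Kac inequality itself comes from the finite-dimensional distributions: one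
  transition over a time step \<open>h\<close> multiplies \<open>u\<close> by at most \<open>exp(- h V) (1 + O(h\<^sup>2))\<close>, these bounds
  are iterated along the times \<open>0, h, 2h, \<dots>\<close>, and Fatou's lemma gives the limit \<open>h \<rightarrow> 0\<close>, in which
  Riemann sums along right-continuous paths converge to the integral of \<open>V(X\<^sub>s)\<close>.
\<close>

section \<open>Exponentials of matrices with bounded rows\<close>

text \<open>The absolute row sums are taken in \<^typ>\<open>ennreal\<close>, so that their finiteness is part of the
  condition and sums over the countable state space can be exchanged freely.\<close>

definition row_bounded :: "('s \<Rightarrow> 's \<Rightarrow> real) \<Rightarrow> real \<Rightarrow> bool" where
  "row_bounded A c \<longleftrightarrow>
     0 \<le> c \<and> (\<forall>x. (\<integral>\<^sup>+ y. ennreal \<bar>A x y\<bar> \<partial>count_space UNIV) \<le> ennreal c)"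

definition matrix_apply :: "('s \<Rightarrow> 's \<Rightarrow> real) \<Rightarrow> ('s \<Rightarrow> real) \<Rightarrow> 's \<Rightarrow> real" where
  "matrix_apply A u x = (LINT y|count_space UNIV. A x y * u y)"

text \<open>If the family is not summable, \<^const>\<open>infsum\<close> is zero by default. Hence the triangle inequality
  holds unconditionally, and matrix powers can be estimated without a side condition on
  summability.\<close>

lemma abs_infsum_le_nn_integral:
  fixes f :: "'a \<Rightarrow> real"
  shows "ennreal \<bar>infsum f UNIV\<bar> \<le> (\<integral>\<^sup>+ x. ennreal \<bar>f x\<bar> \<partial>count_space UNIV)"
proof (cases "f summable_on UNIV")
  case True
  then have "(\<lambda>x. norm (f x)) summable_on UNIV"
    using summable_on_iff_abs_summable_on_real by blast
  then have s: "Infinite_Set_Sum.abs_summable_on f UNIV"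
    using abs_summable_equivalent by blast
  then have i: "integrable (count_space UNIV) f"
    by (simp add: Infinite_Set_Sum.abs_summable_on_def)
  have "infsum f UNIV = (LINT x|count_space UNIV. f x)"
    using infsetsum_infsum[OF s] by (simp add: infsetsum_def)
  also have "ennreal \<bar>\<dots>\<bar> \<le> (\<integral>\<^sup>+ x. ennreal \<bar>f x\<bar> \<partial>count_space UNIV)"
    using integral_norm_bound_ennreal[OF i] by simp
  finally show ?thesis .
next
  case False
  then show ?thesis by (simp add: infsum_not_exists)
qed

lemma row_bounded_matrix_power:
  fixes A :: "'s::countable \<Rightarrow> 's \<Rightarrow> real"
  assumes "row_bounded A c"
  shows "(\<integral>\<^sup>+ y. ennreal \<bar>matrix_power A n x y\<bar> \<partial>count_space UNIV) \<le> ennreal (c ^ n)"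
proof (induction n arbitrary: x)
  case 0
  have "(\<integral>\<^sup>+ y. ennreal \<bar>matrix_power A 0 x y\<bar> \<partial>count_space UNIV)
      = (\<integral>\<^sup>+ y. indicator {x} y \<partial>count_space UNIV)"
    by (intro nn_integral_cong) (auto simp: indicator_def)
  then show ?case by simp
next
  case (Suc n)
  have "(\<integral>\<^sup>+ y. ennreal \<bar>matrix_power A (Suc n) x y\<bar> \<partial>count_space UNIV)
     \<le> (\<integral>\<^sup>+ y. \<integral>\<^sup>+ z. ennreal \<bar>A x z * matrix_power A n z y\<bar> \<partial>count_space UNIV \<partial>count_space UNIV)"
    unfolding matrix_power.simps by (intro nn_integral_mono abs_infsum_le_nn_integral)
  also have "\<dots> = (\<integral>\<^sup>+ z. \<integral>\<^sup>+ y. ennreal \<bar>A x z * matrix_power A n z y\<bar> \<partial>count_space UNIV \<partial>count_space UNIV)"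
    by (intro nn_integral_count_space_nn_integral) auto
  also have "\<dots> = (\<integral>\<^sup>+ z. ennreal \<bar>A x z\<bar> * (\<integral>\<^sup>+ y. ennreal \<bar>matrix_power A n z y\<bar> \<partial>count_space UNIV) \<partial>count_space UNIV)"
    by (simp add: abs_mult ennreal_mult nn_integral_cmult)
  also have "\<dots> \<le> (\<integral>\<^sup>+ z. ennreal \<bar>A x z\<bar> * ennreal (c ^ n) \<partial>count_space UNIV)"
    by (intro nn_integral_mono mult_left_mono Suc.IH) auto
  also have "\<dots> = (\<integral>\<^sup>+ z. ennreal \<bar>A x z\<bar> \<partial>count_space UNIV) * ennreal (c ^ n)"
    by (simp add: nn_integral_multc)
  also have "\<dots> \<le> ennreal c * ennreal (c ^ n)"
    using assms by (intro mult_right_mono) (auto simp: row_bounded_def)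
  also have "\<dots> = ennreal (c ^ Suc n)"
    using assms by (simp add: row_bounded_def ennreal_mult)
  finally show ?case .
qed

lemma abs_matrix_power_le:
  fixes A :: "'s::countable \<Rightarrow> 's \<Rightarrow> real"
  assumes "row_bounded A c"
  shows "\<bar>matrix_power A n x y\<bar> \<le> c ^ n"
proof -
  have "ennreal \<bar>matrix_power A n x y\<bar> \<le> ennreal (c ^ n)"
    using nn_integral_ge_point[of y UNIV "\<lambda>y. ennreal \<bar>matrix_power A n x y\<bar>"]
      row_bounded_matrix_power[OF assms, of n x] by (meson UNIV_I order_trans)
  then show ?thesis
    using assms by (subst (asm) ennreal_le_iff) (auto simp: row_bounded_def)
qed

lemma matrix_power_1: "matrix_power A (Suc 0) x y = A x y"
proof -
  have "infsum (\<lambda>z. A x z * (if z = y then 1 else 0)) UNIV = infsum (\<lambda>z. A x z * (if z = y then 1 else 0)) {y}"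
    by (intro infsum_cong_neutral) auto
  then show ?thesis by simp
qed

text \<open>With absolute values, the matrix exponential series from its quadratic term on is at most \<open>h\<^sup>2\<close>
  times the series at time 1 when \<open>h \<le> 1\<close>, and the rows of the latter sum to at most \<open>exp c\<close>.\<close>

lemma transition_prob_first_order:
  fixes A :: "'s::countable \<Rightarrow> 's \<Rightarrow> real"
  assumes A: "row_bounded A c" and h: "0 \<le> h" "h \<le> 1"
  shows "(\<integral>\<^sup>+ y. ennreal \<bar>transition_prob A h x y - (if x = y then 1 else 0) - h * A x y\<bar> \<partial>count_space UNIV)
     \<le> ennreal (h\<^sup>2 * exp c)"
proof -
  have c: "0 \<le> c" using A by (simp add: row_bounded_def)
  define D where "D y n = \<bar>matrix_power A (n + 2) x y\<bar> / fact (n + 2)" for y n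
  define E where "E n = c ^ n / fact n" for n :: nat
  have E: "E sums exp c" unfolding E_def
    using exp_converges[of c] by (simp add: divide_inverse mult.commute)
  have sE: "summable E" using E by (rule sums_summable)
  have D_le: "D y n \<le> E (n + 2)" for y n
    unfolding D_def E_def using abs_matrix_power_le[OF A, of "n + 2" x y]
    by (intro divide_right_mono) auto
  have D0: "0 \<le> D y n" for y n by (simp add: D_def)
  have sE2: "summable (\<lambda>n. E (n + 2))" using sE by (rule summable_ignore_initial_segment)
  have sD: "summable (D y)" for y
    by (rule summable_comparison_test'[OF sE2]) (use D0 D_le in auto)
  have err: "\<bar>transition_prob A h x y - (if x = y then 1 else 0) - h * A x y\<bar> \<le> h\<^sup>2 * (\<Sum>n. D y n)" for y
  proof -
    define a where "a n = h ^ n / fact n * matrix_power A n x y" for n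
    have a_le: "\<bar>a n\<bar> \<le> E n" for n
    proof -
      have "\<bar>a n\<bar> = h ^ n * (\<bar>matrix_power A n x y\<bar> / fact n)"
        using h by (simp add: a_def abs_mult)
      also have "\<dots> \<le> 1 * E n" unfolding E_def using h c abs_matrix_power_le[OF A, of n x y]
        by (intro mult_mono divide_right_mono power_le_one) auto
      finally show ?thesis by simp
    qed
    have sa: "summable a"
      by (rule summable_comparison_test'[OF sE]) (use a_le in auto)
    have "(\<Sum>n. a (n + 2)) = (\<Sum>n. a n) - (\<Sum>i<2. a i)"
      using suminf_minus_initial_segment[OF sa, of 2] .
    also have "(\<Sum>i<2. a i) = (if x = y then 1 else 0) + h * A x y"
      unfolding numeral_2_eq_2 lessThan_Suc by (simp add: a_def matrix_power_1 del: matrix_power.simps(2))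
    finally have eq: "transition_prob A h x y - (if x = y then 1 else 0) - h * A x y = (\<Sum>n. a (n + 2))"
      by (simp add: transition_prob_def a_def)
    have a2: "\<bar>a (n + 2)\<bar> \<le> h\<^sup>2 * D y n" for n
    proof -
      have "\<bar>a (n + 2)\<bar> = h ^ n * (h\<^sup>2 * D y n)"
        using h by (simp add: a_def abs_mult D_def power2_eq_square)
      also have "\<dots> \<le> 1 * (h\<^sup>2 * D y n)"
        using h by (intro mult_right_mono power_le_one mult_nonneg_nonneg D0) auto
      finally show ?thesis by simp
    qed
    have s2: "summable (\<lambda>n. h\<^sup>2 * D y n)" by (intro summable_mult sD)
    have s3: "summable (\<lambda>n. \<bar>a (n + 2)\<bar>)"
      by (rule summable_comparison_test'[OF s2]) (use a2 in auto)
    have "\<bar>\<Sum>n. a (n + 2)\<bar> \<le> (\<Sum>n. \<bar>a (n + 2)\<bar>)" by (rule summable_rabs[OF s3])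
    also have "\<dots> \<le> (\<Sum>n. h\<^sup>2 * D y n)" by (rule suminf_le[OF a2 s3 s2])
    also have "\<dots> = h\<^sup>2 * (\<Sum>n. D y n)" by (rule suminf_mult[OF sD])
    finally show ?thesis by (simp add: eq)
  qed
  have "(\<integral>\<^sup>+ y. ennreal \<bar>transition_prob A h x y - (if x = y then 1 else 0) - h * A x y\<bar> \<partial>count_space UNIV)
     \<le> (\<integral>\<^sup>+ y. ennreal (h\<^sup>2) * (\<Sum>n. ennreal (D y n)) \<partial>count_space UNIV)"
  proof (intro nn_integral_mono)
    fix y
    have "ennreal (h\<^sup>2) * (\<Sum>n. ennreal (D y n)) = ennreal (h\<^sup>2 * (\<Sum>n. D y n))"
      using D0 sD by (simp add: suminf_ennreal2 ennreal_mult suminf_nonneg)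
    then show "ennreal \<bar>transition_prob A h x y - (if x = y then 1 else 0) - h * A x y\<bar>
        \<le> ennreal (h\<^sup>2) * (\<Sum>n. ennreal (D y n))"
      using err[of y] by (simp add: ennreal_leI)
  qed
  also have "\<dots> = ennreal (h\<^sup>2) * (\<Sum>n. \<integral>\<^sup>+ y. ennreal (D y n) \<partial>count_space UNIV)"
    by (simp add: nn_integral_cmult nn_integral_suminf)
  also have "\<dots> \<le> ennreal (h\<^sup>2) * (\<Sum>n. ennreal (E (n + 2)))"
  proof (intro mult_left_mono suminf_le)
    fix n
    have "(\<integral>\<^sup>+ y. ennreal (D y n) \<partial>count_space UNIV)
       = (\<integral>\<^sup>+ y. ennreal (1 / fact (n + 2)) * ennreal \<bar>matrix_power A (n + 2) x y\<bar> \<partial>count_space UNIV)"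
      by (intro nn_integral_cong) (simp add: D_def flip: ennreal_mult)
    also have "\<dots> = ennreal (1 / fact (n + 2)) * (\<integral>\<^sup>+ y. ennreal \<bar>matrix_power A (n + 2) x y\<bar> \<partial>count_space UNIV)"
      by (simp add: nn_integral_cmult)
    also have "\<dots> \<le> ennreal (1 / fact (n + 2)) * ennreal (c ^ (n + 2))"
      by (intro mult_left_mono row_bounded_matrix_power A) auto
    also have "\<dots> = ennreal (E (n + 2))"
      using c by (simp add: E_def flip: ennreal_mult)
    finally show "(\<integral>\<^sup>+ y. ennreal (D y n) \<partial>count_space UNIV) \<le> ennreal (E (n + 2))" .
  qed auto
  also have "(\<Sum>n. ennreal (E (n + 2))) = ennreal (\<Sum>n. E (n + 2))"
    using c by (intro suminf_ennreal2 sE2) (auto simp: E_def)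
  also have "(\<Sum>n. E (n + 2)) \<le> exp c"
  proof -
    have "0 \<le> (\<Sum>i<2. E i)" using c by (intro sum_nonneg) (auto simp: E_def)
    then show ?thesis
      using suminf_minus_initial_segment[OF sE, of 2] sums_unique[OF E] by simp
  qed
  finally show ?thesis
    by (simp add: ennreal_mult mult_left_mono ennreal_leI)
qed

lemma integrable_row:
  assumes "row_bounded A c" and "\<And>y. \<bar>u y\<bar> \<le> b"
  shows "integrable (count_space UNIV) (\<lambda>y. A x y * u y)"
proof (rule Bochner_Integration.integrable_bound)
  have "(\<integral>\<^sup>+ y. ennreal \<bar>A x y\<bar> \<partial>count_space UNIV) < \<infinity>"
    using assms(1) unfolding row_bounded_def by (metis ennreal_less_top infinity_ennreal_def le_less_trans)
  then have "integrable (count_space UNIV) (A x)"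
    by (intro integrableI_bounded) auto
  then show "integrable (count_space UNIV) (\<lambda>y. A x y * b)" by simp
  have "0 \<le> b" using assms(2) by (meson abs_ge_zero order_trans)
  then show "AE y in count_space UNIV. norm (A x y * u y) \<le> norm (A x y * b)"
    using assms(2) by (auto simp: abs_mult intro!: mult_left_mono)
qed auto

lemma abs_matrix_apply_le:
  assumes A: "row_bounded A c" and u: "\<And>y. \<bar>u y\<bar> \<le> b"
  shows "\<bar>matrix_apply A u x\<bar> \<le> c * b"
proof -
  have b: "0 \<le> b" using u by (meson abs_ge_zero order_trans)
  have c: "0 \<le> c" using A by (simp add: row_bounded_def)
  have "ennreal \<bar>matrix_apply A u x\<bar> \<le> (\<integral>\<^sup>+ y. ennreal \<bar>A x y * u y\<bar> \<partial>count_space UNIV)"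
    unfolding matrix_apply_def using integral_norm_bound_ennreal[OF integrable_row[OF A u]] by simp
  also have "\<dots> \<le> (\<integral>\<^sup>+ y. ennreal \<bar>A x y\<bar> * ennreal b \<partial>count_space UNIV)"
    using u b by (intro nn_integral_mono)
      (auto simp: abs_mult intro!: ennreal_leI mult_left_mono simp flip: ennreal_mult)
  also have "\<dots> = (\<integral>\<^sup>+ y. ennreal \<bar>A x y\<bar> \<partial>count_space UNIV) * ennreal b"
    by (simp add: nn_integral_multc)
  also have "\<dots> \<le> ennreal c * ennreal b"
    using A by (intro mult_right_mono) (auto simp: row_bounded_def)
  finally show ?thesis using b c by (simp flip: ennreal_mult)
qed

text \<open>Applies the first-order expansion of the transition matrix to a function. Nonnegative
  transition probabilities turn the left-hand side into the integral of a real function; for a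
  Markov chain they are available at every state that is visited with positive probability.\<close>

lemma transition_drift:
  fixes A :: "'s::countable \<Rightarrow> 's \<Rightarrow> real"
  assumes A: "row_bounded A c" and h: "0 \<le> h" "h \<le> 1"
    and u: "\<And>y. 0 \<le> u y" "\<And>y. u y \<le> b"
    and p: "\<And>y. 0 \<le> transition_prob A h x y"
  shows "(\<integral>\<^sup>+ y. ennreal (transition_prob A h x y * u y) \<partial>count_space UNIV)
     \<le> ennreal (u x + h * matrix_apply A u x + h\<^sup>2 * exp c * b)"
proof -
  define e where "e y = transition_prob A h x y - (if x = y then 1 else 0) - h * A x y" for y
  have b: "0 \<le> b" using u by (meson order_trans)
  have au: "\<bar>u y\<bar> \<le> b" for y using u by simp
  have ne: "(\<integral>\<^sup>+ y. ennreal \<bar>e y\<bar> \<partial>count_space UNIV) \<le> ennreal (h\<^sup>2 * exp c)"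
    unfolding e_def by (rule transition_prob_first_order[OF A h])
  have "(\<integral>\<^sup>+ y. ennreal \<bar>e y\<bar> \<partial>count_space UNIV) < \<infinity>"
    using ne by (metis ennreal_less_top infinity_ennreal_def le_less_trans)
  then have ie: "integrable (count_space UNIV) e" by (intro integrableI_bounded) auto
  have ieu: "integrable (count_space UNIV) (\<lambda>y. e y * u y)"
    by (rule Bochner_Integration.integrable_bound[OF integrable_mult_left[OF ie, of b]])
      (use au b in \<open>auto simp: abs_mult intro!: mult_left_mono\<close>)
  have iA: "integrable (count_space UNIV) (\<lambda>y. h * (A x y * u y))"
    using integrable_row[OF A au] by auto
  have id: "has_bochner_integral (count_space UNIV) (\<lambda>y. indicator {x} y *\<^sub>R u x) (1 *\<^sub>R u x)"
    using has_bochner_integral_indicator[of "{x}" "count_space UNIV" "u x"] by simp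
  have decomp: "transition_prob A h x y * u y = indicator {x} y *\<^sub>R u x + h * (A x y * u y) + e y * u y" for y
    by (auto simp: e_def indicator_def algebra_simps)
  have int: "integrable (count_space UNIV) (\<lambda>y. transition_prob A h x y * u y)"
    unfolding decomp using ieu iA id by (intro Bochner_Integration.integrable_add) (auto dest: integrable.intros)
  have "(LINT y|count_space UNIV. transition_prob A h x y * u y)
      = u x + h * matrix_apply A u x + (LINT y|count_space UNIV. e y * u y)"
    unfolding decomp using ieu iA id
    by (simp add: has_bochner_integral_iff matrix_apply_def)
  also have "(LINT y|count_space UNIV. e y * u y) \<le> h\<^sup>2 * exp c * b"
  proof -
    have "ennreal \<bar>LINT y|count_space UNIV. e y * u y\<bar> \<le> (\<integral>\<^sup>+ y. ennreal \<bar>e y * u y\<bar> \<partial>count_space UNIV)"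
      using integral_norm_bound_ennreal[OF ieu] by simp
    also have "\<dots> \<le> (\<integral>\<^sup>+ y. ennreal \<bar>e y\<bar> * ennreal b \<partial>count_space UNIV)"
      using au b by (intro nn_integral_mono)
        (auto simp: abs_mult intro!: ennreal_leI mult_left_mono simp flip: ennreal_mult)
    also have "\<dots> \<le> ennreal (h\<^sup>2 * exp c) * ennreal b"
      using ne by (simp add: nn_integral_multc mult_right_mono)
    finally show ?thesis using b by (simp flip: ennreal_mult)
  qed
  finally have "(LINT y|count_space UNIV. transition_prob A h x y * u y)
      \<le> u x + h * matrix_apply A u x + h\<^sup>2 * exp c * b" by simp
  moreover have "(\<integral>\<^sup>+ y. ennreal (transition_prob A h x y * u y) \<partial>count_space UNIV)
     = ennreal (LINT y|count_space UNIV. transition_prob A h x y * u y)"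
    using p u by (intro nn_integral_eq_integral int) auto
  ultimately show ?thesis by (simp add: ennreal_leI)
qed

section \<open>A discrete Feynman--Kac inequality\<close>

lemma nn_integral_countable_valued:
  fixes Z :: "'w \<Rightarrow> 'b::countable"
  assumes Z: "Z \<in> measurable M (count_space UNIV)"
  shows "(\<integral>\<^sup>+ \<omega>. \<phi> (Z \<omega>) \<partial>M) = (\<integral>\<^sup>+ z. \<phi> z * emeasure M {\<omega> \<in> space M. Z \<omega> = z} \<partial>count_space UNIV)"
proof -
  have Zs: "{\<omega> \<in> space M. Z \<omega> = z} \<in> sets M" for z
    using measurable_sets[OF Z, of "{z}"] by (simp add: vimage_def Int_def conj_commute)
  have "(\<integral>\<^sup>+ \<omega>. \<phi> (Z \<omega>) \<partial>M)
      = (\<integral>\<^sup>+ \<omega>. \<integral>\<^sup>+ z. \<phi> z * indicator {\<omega> \<in> space M. Z \<omega> = z} \<omega> \<partial>count_space UNIV \<partial>M)"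
  proof (intro nn_integral_cong)
    fix \<omega> assume "\<omega> \<in> space M"
    then have "(\<integral>\<^sup>+ z. \<phi> z * indicator {\<omega> \<in> space M. Z \<omega> = z} \<omega> \<partial>count_space UNIV)
       = (\<integral>\<^sup>+ z. \<phi> z * indicator {Z \<omega>} z \<partial>count_space UNIV)"
      by (intro nn_integral_cong) (auto simp: indicator_def)
    then show "\<phi> (Z \<omega>) = (\<integral>\<^sup>+ z. \<phi> z * indicator {\<omega> \<in> space M. Z \<omega> = z} \<omega> \<partial>count_space UNIV)"
      by simp
  qed
  also have "\<dots> = (\<integral>\<^sup>+ z. \<integral>\<^sup>+ \<omega>. \<phi> z * indicator {\<omega> \<in> space M. Z \<omega> = z} \<omega> \<partial>M \<partial>count_space UNIV)"
    using Zs by (intro nn_integral_count_space_nn_integral) auto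
  also have "\<dots> = (\<integral>\<^sup>+ z. \<phi> z * emeasure M {\<omega> \<in> space M. Z \<omega> = z} \<partial>count_space UNIV)"
    using Zs by (simp add: nn_integral_cmult_indicator)
  finally show ?thesis .
qed

text \<open>The path at the times \<open>0, h, \<dots>, n h\<close>. A list over a countable type ranges over a countable
  type, so expectations of its functions are sums over its values.\<close>

definition skeleton :: "(real \<Rightarrow> 'w \<Rightarrow> 's) \<Rightarrow> real \<Rightarrow> nat \<Rightarrow> 'w \<Rightarrow> 's list" where
  "skeleton X h n \<omega> = map (\<lambda>i. X (real i * h) \<omega>) [0..<Suc n]"

lemma skeleton_eq_iff:
  "skeleton X h n \<omega> = xs \<longleftrightarrow> length xs = Suc n \<and> (\<forall>i\<le>n. X (real i * h) \<omega> = xs ! i)"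
  unfolding skeleton_def by (auto simp: list_eq_iff_nth_eq less_Suc_eq_le simp del: upt_Suc)

lemma nth_skeleton: "i \<le> n \<Longrightarrow> skeleton X h n \<omega> ! i = X (real i * h) \<omega>"
  using skeleton_eq_iff[of X h n \<omega> "skeleton X h n \<omega>"] by simp

lemma measurable_skeleton:
  fixes X :: "real \<Rightarrow> 'w \<Rightarrow> 's::countable"
  assumes "markov_chain M X A a" and h: "0 \<le> h"
  shows "skeleton X h n \<in> measurable M (count_space UNIV)"
proof -
  interpret markov_chain M X A a by fact
  have X: "{\<omega> \<in> space M. X (real i * h) \<omega> = x} \<in> sets M" for i x
    using measurable_sets[OF measurable_state, of "real i * h" "{x}"] h
    by (simp add: vimage_def Int_def conj_commute)
  have "skeleton X h n -` {xs} \<inter> space M \<in> sets M" for xs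
  proof (cases "length xs = Suc n")
    case True
    have "skeleton X h n -` {xs} \<inter> space M = {\<omega> \<in> space M. skeleton X h n \<omega> = xs}" by auto
    also have "\<dots> = (\<Inter>i\<in>{..n}. {\<omega> \<in> space M. X (real i * h) \<omega> = xs ! i})"
      unfolding skeleton_eq_iff using True by auto
    finally show ?thesis using X by auto
  next
    case False
    then have "skeleton X h n \<omega> \<noteq> xs" for \<omega> by (simp add: skeleton_eq_iff)
    then have "skeleton X h n -` {xs} \<inter> space M = {}" by auto
    then show ?thesis by simp
  qed
  then show ?thesis by (subst measurable_count_space_eq2_countable) auto
qed

lemma prob_skeleton_Suc:
  fixes X :: "real \<Rightarrow> 'w \<Rightarrow> 's::countable"
  assumes "markov_chain M X A a" and h: "0 \<le> h" and len: "length xs = Suc n"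
  shows "measure M {\<omega> \<in> space M. skeleton X h n \<omega> = xs \<and> X (real (Suc n) * h) \<omega> = y}
     = measure M {\<omega> \<in> space M. skeleton X h n \<omega> = xs} * transition_prob A h (xs ! n) y"
proof -
  interpret markov_chain M X A a by fact
  have mono: "real i * h \<le> real (Suc i) * h" for i
    using h by (intro mult_right_mono) auto
  have diff: "real (Suc i) * h - real i * h = h" for i
    by (simp add: algebra_simps)
  have *: "measure M {\<omega> \<in> space M. \<forall>i\<le>k. X (real i * h) \<omega> = x i}
      = (if x 0 = a then 1 else 0) * (\<Prod>i<k. transition_prob A h (x i) (x (Suc i)))" for k x
    using finite_dim_distributions[of "\<lambda>i. real i * h" k x] mono by (simp only: diff)
  have "{\<omega> \<in> space M. skeleton X h n \<omega> = xs \<and> X (real (Suc n) * h) \<omega> = y}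
      = {\<omega> \<in> space M. \<forall>i\<le>Suc n. X (real i * h) \<omega> = (xs @ [y]) ! i}"
    using len by (auto simp: skeleton_eq_iff nth_append le_Suc_eq)
  moreover have "{\<omega> \<in> space M. skeleton X h n \<omega> = xs} = {\<omega> \<in> space M. \<forall>i\<le>n. X (real i * h) \<omega> = xs ! i}"
    using len by (auto simp: skeleton_eq_iff)
  moreover have "(\<Prod>i<n. transition_prob A h ((xs @ [y]) ! i) ((xs @ [y]) ! Suc i))
      = (\<Prod>i<n. transition_prob A h (xs ! i) (xs ! Suc i))"
    using len by (intro prod.cong) (auto simp: nth_append)
  ultimately show ?thesis
    unfolding * using len by (simp add: * nth_append)
qed

text \<open>The Markov property for the time step \<open>h\<close>, as an inequality. Conditioning on the values of the
  skeleton reduces it to single values \<open>xs\<close>. If \<open>xs\<close> has positive probability, then the transition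
  probabilities out of its last state are quotients of probabilities, hence nonnegative, and \<open>w\<close>
  applies; otherwise both sides vanish.\<close>

lemma skeleton_step:
  fixes X :: "real \<Rightarrow> 'w \<Rightarrow> 's::countable" and f w :: "'s \<Rightarrow> ennreal"
  assumes mc: "markov_chain M X A a" and h: "0 \<le> h"
    and w: "\<And>x. (\<And>y. 0 \<le> transition_prob A h x y) \<Longrightarrow>
        (\<integral>\<^sup>+ y. ennreal (transition_prob A h x y) * f y \<partial>count_space UNIV) \<le> w x"
  shows "(\<integral>\<^sup>+ \<omega>. G (skeleton X h n \<omega>) * f (X (real (Suc n) * h) \<omega>) \<partial>M)
     \<le> (\<integral>\<^sup>+ \<omega>. G (skeleton X h n \<omega>) * w (X (real n * h) \<omega>) \<partial>M)"
proof -
  interpret markov_chain M X A a by fact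
  define Y where "Y = skeleton X h n"
  define X' where "X' = X (real (Suc n) * h)"
  have Y: "Y \<in> measurable M (count_space UNIV)"
    unfolding Y_def by (rule measurable_skeleton[OF mc h])
  have X': "X' \<in> measurable M (count_space UNIV)"
    unfolding X'_def using h by (intro measurable_state) auto
  have YX': "(\<lambda>\<omega>. (Y \<omega>, X' \<omega>)) \<in> measurable M (count_space UNIV)"
    using measurable_Pair[OF Y X'] by (simp add: pair_measure_countable)
  have last: "X (real n * h) \<omega> = Y \<omega> ! n" for \<omega>
    by (simp add: Y_def nth_skeleton)
  have Ysets: "{\<omega> \<in> space M. Y \<omega> = xs} \<in> sets M" for xs
    using measurable_sets[OF Y, of "{xs}"] by (simp add: vimage_def Int_def conj_commute)
  have joint: "(\<integral>\<^sup>+ y. f y * emeasure M {\<omega> \<in> space M. Y \<omega> = xs \<and> X' \<omega> = y} \<partial>count_space UNIV)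
     \<le> w (xs ! n) * emeasure M {\<omega> \<in> space M. Y \<omega> = xs}" for xs
  proof (cases "measure M {\<omega> \<in> space M. Y \<omega> = xs} = 0")
    case True
    then have "emeasure M {\<omega> \<in> space M. Y \<omega> = xs} = 0"
      by (simp add: emeasure_eq_measure)
    then have "emeasure M {\<omega> \<in> space M. Y \<omega> = xs \<and> X' \<omega> = y} = 0" for y
      using emeasure_mono[OF _ Ysets[of xs], of "{\<omega> \<in> space M. Y \<omega> = xs \<and> X' \<omega> = y}"] by auto
    then show ?thesis by simp
  next
    case False
    then have pos: "0 < measure M {\<omega> \<in> space M. Y \<omega> = xs}"
      by (simp add: zero_less_measure_iff)
    have len: "length xs = Suc n"
    proof (rule ccontr)
      assume "length xs \<noteq> Suc n"
      then have none: "{\<omega> \<in> space M. Y \<omega> = xs} = {}" by (auto simp: Y_def skeleton_eq_iff)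
      show False using pos unfolding none by simp
    qed
    have fac: "measure M {\<omega> \<in> space M. Y \<omega> = xs \<and> X' \<omega> = y}
       = measure M {\<omega> \<in> space M. Y \<omega> = xs} * transition_prob A h (xs ! n) y" for y
      unfolding Y_def X'_def by (rule prob_skeleton_Suc[OF mc h len])
    have p: "0 \<le> transition_prob A h (xs ! n) y" for y
    proof -
      have "0 \<le> measure M {\<omega> \<in> space M. Y \<omega> = xs} * transition_prob A h (xs ! n) y"
        unfolding fac[symmetric] by (rule measure_nonneg)
      then show ?thesis using pos by (simp add: zero_le_mult_iff)
    qed
    have "(\<integral>\<^sup>+ y. f y * emeasure M {\<omega> \<in> space M. Y \<omega> = xs \<and> X' \<omega> = y} \<partial>count_space UNIV)
      = (\<integral>\<^sup>+ y. (ennreal (transition_prob A h (xs ! n) y) * f y) * emeasure M {\<omega> \<in> space M. Y \<omega> = xs} \<partial>count_space UNIV)"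
      using p by (intro nn_integral_cong) (simp add: emeasure_eq_measure fac ennreal_mult mult_ac)
    also have "\<dots> = (\<integral>\<^sup>+ y. ennreal (transition_prob A h (xs ! n) y) * f y \<partial>count_space UNIV) * emeasure M {\<omega> \<in> space M. Y \<omega> = xs}"
      by (simp add: nn_integral_multc)
    also have "\<dots> \<le> w (xs ! n) * emeasure M {\<omega> \<in> space M. Y \<omega> = xs}"
      by (intro mult_right_mono w p) auto
    finally show ?thesis .
  qed
  have "(\<integral>\<^sup>+ \<omega>. G (Y \<omega>) * f (X' \<omega>) \<partial>M)
     = (\<integral>\<^sup>+ z. (G (fst z) * f (snd z)) * emeasure M {\<omega> \<in> space M. (Y \<omega>, X' \<omega>) = z} \<partial>count_space UNIV)"
    using nn_integral_countable_valued[OF YX', of "\<lambda>z. G (fst z) * f (snd z)"] by simp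
  also have "\<dots> = (\<integral>\<^sup>+ xs. \<integral>\<^sup>+ y. G xs * (f y * emeasure M {\<omega> \<in> space M. Y \<omega> = xs \<and> X' \<omega> = y}) \<partial>count_space UNIV \<partial>count_space UNIV)"
    by (subst nn_integral_fst_count_space[symmetric]) (simp add: mult.assoc)
  also have "\<dots> = (\<integral>\<^sup>+ xs. G xs * (\<integral>\<^sup>+ y. f y * emeasure M {\<omega> \<in> space M. Y \<omega> = xs \<and> X' \<omega> = y} \<partial>count_space UNIV) \<partial>count_space UNIV)"
    by (simp add: nn_integral_cmult)
  also have "\<dots> \<le> (\<integral>\<^sup>+ xs. G xs * (w (xs ! n) * emeasure M {\<omega> \<in> space M. Y \<omega> = xs}) \<partial>count_space UNIV)"
    by (intro nn_integral_mono mult_left_mono joint) auto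
  also have "\<dots> = (\<integral>\<^sup>+ \<omega>. G (Y \<omega>) * w (Y \<omega> ! n) \<partial>M)"
    using nn_integral_countable_valued[OF Y, of "\<lambda>xs. G xs * w (xs ! n)"] by (simp add: mult.assoc)
  finally show ?thesis
    unfolding last X'_def Y_def .
qed

lemma initial_state:
  assumes "markov_chain M X A a"
  shows "AE \<omega> in M. X 0 \<omega> = a"
proof -
  interpret markov_chain M X A a by fact
  have "{\<omega> \<in> space M. X 0 \<omega> = a} \<in> sets M"
    using measurable_sets[OF measurable_state[of 0], of "{a}"] by (simp add: vimage_def Int_def conj_commute)
  moreover have "prob {\<omega> \<in> space M. X 0 \<omega> = a} = 1"
    using finite_dim_distributions[of "\<lambda>i. 0" 0 "\<lambda>i. a"] by simp
  ultimately show ?thesis using AE_iff_emeasure_eq_1 by (simp add: emeasure_eq_measure)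
qed

lemma abs_potential_le:
  assumes A: "row_bounded A c" and u: "\<And>x. 1 \<le> u x" "\<And>x. u x \<le> b"
    and V: "\<And>x. V x = - matrix_apply A u x / u x"
  shows "\<bar>V x\<bar> \<le> c * b"
proof -
  have "\<bar>u y\<bar> \<le> b" for y using u[of y] by linarith
  then have "\<bar>matrix_apply A u x\<bar> \<le> c * b" by (intro abs_matrix_apply_le[OF A])
  moreover have "\<bar>V x\<bar> \<le> \<bar>matrix_apply A u x\<bar> / 1"
    unfolding V abs_divide abs_minus_cancel using u(1)[of x] by (intro divide_left_mono) auto
  ultimately show ?thesis by simp
qed

text \<open>To first order in \<open>h\<close>, the transition matrix maps \<open>u\<close> to \<open>u + h A u = u (1 - h V) \<le> u exp(- h V)\<close>.
  The error is at most \<open>exp c * b * h\<^sup>2\<close>. It is absorbed into a factor because \<open>u \<ge> 1\<close> and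
  \<open>exp(- h V) \<ge> exp(- c b)\<close>, and the last bound contributes \<open>exp (c * b)\<close> to the constant.\<close>

lemma transition_supersolution:
  fixes A :: "'s::countable \<Rightarrow> 's \<Rightarrow> real"
  assumes A: "row_bounded A c" and u: "\<And>x. 1 \<le> u x" "\<And>x. u x \<le> b"
    and V: "\<And>x. V x = - matrix_apply A u x / u x"
    and h: "0 \<le> h" "h \<le> 1" and p: "\<And>y. 0 \<le> transition_prob A h x y"
  shows "(\<integral>\<^sup>+ y. ennreal (transition_prob A h x y * u y) \<partial>count_space UNIV)
     \<le> ennreal ((1 + exp c * b * exp (c * b) * h\<^sup>2) * (u x * exp (- h * V x)))"
proof -
  have u0: "0 < u x" for x using u(1)[of x] by linarith
  have b: "0 \<le> b" using u0 u(2) by (meson less_imp_le order_trans)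
  have c: "0 \<le> c" using A by (simp add: row_bounded_def)
  have Au: "matrix_apply A u x = - u x * V x" using u0[of x] by (simp add: V)
  have "V x \<le> c * b" using abs_potential_le[OF A u V, of x] by simp
  then have "h * V x \<le> 1 * (c * b)" 
    using h b c by (meson mult_left_mono mult_right_mono mult_nonneg_nonneg order_trans)
  then have e1: "1 \<le> exp (c * b) * exp (- h * V x)"
    by (simp add: exp_add[symmetric])
  have "u x + h * matrix_apply A u x + h\<^sup>2 * exp c * b
     = u x * (1 + - h * V x) + h\<^sup>2 * exp c * b"
    by (simp add: Au algebra_simps)
  also have "\<dots> \<le> u x * exp (- h * V x) + h\<^sup>2 * exp c * b * (u x * (exp (c * b) * exp (- h * V x)))"
  proof (intro add_mono mult_left_mono exp_ge_add_one_self less_imp_le[OF u0])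
    have "1 * 1 \<le> u x * (exp (c * b) * exp (- h * V x))"
      using u(1)[of x] e1 by (intro mult_mono) auto
    then show "h\<^sup>2 * exp c * b \<le> h\<^sup>2 * exp c * b * (u x * (exp (c * b) * exp (- h * V x)))"
      using mult_left_mono[of 1 _ "h\<^sup>2 * exp c * b"] b by simp
  qed
  also have "\<dots> = (1 + exp c * b * exp (c * b) * h\<^sup>2) * (u x * exp (- h * V x))"
    by (simp add: algebra_simps)
  finally show ?thesis
    using transition_drift[OF A h _ u(2) p] u0
    by (meson ennreal_leI less_imp_le order_trans)
qed

text \<open>Each step removes the last factor \<open>exp(h V)\<close> at the price of a factor \<open>1 + O(h\<^sup>2)\<close>. Over a fixed
  time horizon there are \<open>O(1 / h)\<close> steps, so the total price tends to 1 as \<open>h \<rightarrow> 0\<close>.\<close>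

lemma discrete_feynman_kac:
  fixes X :: "real \<Rightarrow> 'w \<Rightarrow> 's::countable"
  assumes mc: "markov_chain M X A a" and A: "row_bounded A c"
    and u: "\<And>x. 1 \<le> u x" "\<And>x. u x \<le> b"
    and V: "\<And>x. V x = - matrix_apply A u x / u x"
    and h: "0 \<le> h" "h \<le> 1"
  shows "(\<integral>\<^sup>+ \<omega>. ennreal (exp (h * (\<Sum>i<n. V (X (real i * h) \<omega>))) * u (X (real n * h) \<omega>)) \<partial>M)
     \<le> ennreal ((1 + exp c * b * exp (c * b) * h\<^sup>2) ^ n * u a)"
proof (induction n)
  case 0
  interpret markov_chain M X A a by fact
  have "(\<integral>\<^sup>+ \<omega>. ennreal (u (X 0 \<omega>)) \<partial>M) = (\<integral>\<^sup>+ \<omega>. ennreal (u a) \<partial>M)"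
    using initial_state[OF mc] by (intro nn_integral_cong_AE) auto
  then show ?case by (simp add: emeasure_space_1)
next
  case (Suc n)
  define K where "K = 1 + exp c * b * exp (c * b) * h\<^sup>2"
  have b: "0 \<le> b" using u[of undefined] by linarith
  have K: "0 \<le> K" using b by (simp add: K_def)
  have u0: "0 \<le> u x" for x using u(1)[of x] by linarith
  define G where "G xs = ennreal (exp (h * (\<Sum>i<Suc n. V (xs ! i))))" for xs
  have G: "G (skeleton X h n \<omega>) = ennreal (exp (h * (\<Sum>i<Suc n. V (X (real i * h) \<omega>))))" for \<omega>
  proof -
    have "(\<Sum>i<Suc n. V (skeleton X h n \<omega> ! i)) = (\<Sum>i<Suc n. V (X (real i * h) \<omega>))"
      by (rule sum.cong) (auto simp: nth_skeleton)
    then show ?thesis by (simp only: G_def)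
  qed
  have "(\<integral>\<^sup>+ \<omega>. ennreal (exp (h * (\<Sum>i<Suc n. V (X (real i * h) \<omega>))) * u (X (real (Suc n) * h) \<omega>)) \<partial>M)
      = (\<integral>\<^sup>+ \<omega>. G (skeleton X h n \<omega>) * ennreal (u (X (real (Suc n) * h) \<omega>)) \<partial>M)"
    unfolding G using u0 by (intro nn_integral_cong) (simp add: ennreal_mult)
  also have "\<dots> \<le> (\<integral>\<^sup>+ \<omega>. G (skeleton X h n \<omega>) * ennreal (K * (u (X (real n * h) \<omega>) * exp (- h * V (X (real n * h) \<omega>)))) \<partial>M)"
  proof (rule skeleton_step[OF mc h(1)])
    fix x assume p: "\<And>y. 0 \<le> transition_prob A h x y"
    show "(\<integral>\<^sup>+ y. ennreal (transition_prob A h x y) * ennreal (u y) \<partial>count_space UNIV)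
       \<le> ennreal (K * (u x * exp (- h * V x)))"
      using transition_supersolution[OF A u V h p] p u0 by (simp add: K_def ennreal_mult)
  qed
  also have "\<dots> = (\<integral>\<^sup>+ \<omega>. ennreal K * ennreal (exp (h * (\<Sum>i<n. V (X (real i * h) \<omega>))) * u (X (real n * h) \<omega>)) \<partial>M)"
  proof (intro nn_integral_cong)
    fix \<omega>
    have "exp (h * (\<Sum>i<Suc n. V (X (real i * h) \<omega>))) * (K * (u (X (real n * h) \<omega>) * exp (- h * V (X (real n * h) \<omega>))))
       = K * (exp (h * (\<Sum>i<n. V (X (real i * h) \<omega>))) * u (X (real n * h) \<omega>))"
      by (simp add: distrib_left exp_add exp_minus field_simps)
    then show "G (skeleton X h n \<omega>) * ennreal (K * (u (X (real n * h) \<omega>) * exp (- h * V (X (real n * h) \<omega>))))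
       = ennreal K * ennreal (exp (h * (\<Sum>i<n. V (X (real i * h) \<omega>))) * u (X (real n * h) \<omega>))"
      unfolding G using K u0 by (simp del: sum.lessThan_Suc flip: ennreal_mult)
  qed
  also have "\<dots> = ennreal K * (\<integral>\<^sup>+ \<omega>. ennreal (exp (h * (\<Sum>i<n. V (X (real i * h) \<omega>))) * u (X (real n * h) \<omega>)) \<partial>M)"
  proof (rule nn_integral_cmult)
    interpret markov_chain M X A a by fact
    have [measurable]: "X (real i * h) \<in> measurable M (count_space UNIV)" for i
      using h by (intro measurable_state) auto
    show "(\<lambda>\<omega>. ennreal (exp (h * (\<Sum>i<n. V (X (real i * h) \<omega>))) * u (X (real n * h) \<omega>))) \<in> borel_measurable M"
      by measurable
  qed
  also have "\<dots> \<le> ennreal K * ennreal (K ^ n * u a)"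
    using Suc.IH by (intro mult_left_mono) (auto simp: K_def)
  also have "\<dots> = ennreal (K ^ Suc n * u a)"
    using K u0 by (simp add: mult.assoc flip: ennreal_mult)
  finally show ?case by (simp add: K_def)
qed

section \<open>Occupation times of right-continuous paths\<close>

text \<open>The points of evaluation lie at the right ends of the intervals of the partition. A function
  that is merely right-continuous, without left limits, need not be approximated by its values at the
  left ends, whereas the right end following \<open>s\<close> tends to \<open>s\<close> from the right, where the
  values converge.\<close>

lemma right_riemann_sums:
  fixes f :: "real \<Rightarrow> real"
  assumes T: "0 < T" and f: "\<And>t. 0 \<le> t \<Longrightarrow> t < T \<Longrightarrow> (f \<longlongrightarrow> f t) (at_right t)"
    and b: "\<And>t. \<bar>f t\<bar> \<le> b"
  shows set_integrable_right_continuous: "set_integrable lborel {0..T} f"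
    and right_riemann_sums_LIMSEQ:
      "(\<lambda>n. \<Sum>i<Suc n. T / real (Suc n) * f (real (Suc i) * (T / real (Suc n))))
         \<longlonglongrightarrow> (LINT s:{0..T}|lborel. f s)"
proof -
  define h where "h n = T / real (Suc n)" for n
  define g where "g n s = (\<Sum>i<Suc n. f (real (Suc i) * h n) * indicator {real i * h n..<real (Suc i) * h n} s)" for n s
  define F where "F s = indicator {0..<T} s * f s" for s :: real
  have h: "0 < h n" "real (Suc n) * h n = T" for n using T by (auto simp: h_def)
  have b0: "0 \<le> b" using b by (meson abs_ge_zero order_trans)
  have h0: "h \<longlonglongrightarrow> 0" unfolding h_def
    using LIMSEQ_Suc[OF tendsto_mult_right_zero[OF lim_inverse_n, of T]] by (simp add: divide_inverse)
  \<comment> \<open>The right end of the interval of the partition that contains \<open>s\<close>.\<close>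
  define r where "r n s = real (Suc (nat \<lfloor>s / h n\<rfloor>)) * h n" for n s
  have g_in: "g n s = f (r n s)" if s: "0 \<le> s" "s < T" for n s
  proof -
    define k where "k = nat \<lfloor>s / h n\<rfloor>"
    have k: "k < Suc n"
    proof -
      have "s / h n < real (Suc n)" using s h[of n] by (simp add: pos_divide_less_eq)
      then have "\<lfloor>s / h n\<rfloor> < int (Suc n)" by (simp add: floor_less_iff)
      then show ?thesis by (simp add: k_def nat_less_iff) 
    qed
    have ind: "indicator {real i * h n..<real (Suc i) * h n} s = (if i = k then 1 else 0 :: real)" for i
    proof -
      have "s \<in> {real i * h n..<real (Suc i) * h n} \<longleftrightarrow> real i \<le> s / h n \<and> s / h n < real i + 1"
        using h(1)[of n] by (simp add: pos_le_divide_eq pos_divide_less_eq algebra_simps)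
      also have "\<dots> \<longleftrightarrow> \<lfloor>s / h n\<rfloor> = int i" by (simp add: floor_eq_iff)
      also have "\<dots> \<longleftrightarrow> i = k"
        using s h(1)[of n] by (auto simp: k_def)
      finally show ?thesis by (simp add: indicator_def)
    qed
    show ?thesis unfolding g_def ind r_def k_def[symmetric]
      using k by (simp add: if_distrib[of "\<lambda>z. _ * z"] cong: if_cong)
  qed
  have g_out: "g n s = 0" if s: "s \<notin> {0..<T}" for n s
  proof -
    have "indicator {real i * h n..<real (Suc i) * h n} s = (0::real)" if i: "i < Suc n" for i
    proof -
      have "real (Suc i) * h n \<le> real (Suc n) * h n" using i h[of n] by (intro mult_right_mono) auto
      moreover have "0 \<le> real i * h n" using h(1)[of n] by simp
      ultimately show ?thesis using s h(2)[of n] by (auto simp: indicator_def)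
    qed
    then show ?thesis unfolding g_def by (intro sum.neutral) auto
  qed
  have lim: "(\<lambda>n. g n s) \<longlonglongrightarrow> F s" for s
  proof (cases "s \<in> {0..<T}")
    case True
    have gt: "s < r n s" and le: "r n s \<le> s + h n" for n
    proof -
      have k: "real (nat \<lfloor>s / h n\<rfloor>) = of_int \<lfloor>s / h n\<rfloor>" using True h(1)[of n] by simp
      have "s / h n < real (Suc (nat \<lfloor>s / h n\<rfloor>))" using k by linarith
      then show "s < r n s" using h(1)[of n] by (simp add: r_def pos_divide_less_eq)
      have "real (nat \<lfloor>s / h n\<rfloor>) \<le> s / h n" using k by linarith
      then have "real (nat \<lfloor>s / h n\<rfloor>) * h n \<le> s" using h(1)[of n] by (simp add: pos_le_divide_eq)
      then show "r n s \<le> s + h n" by (simp add: r_def algebra_simps)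
    qed
    have "(\<lambda>n. r n s) \<longlonglongrightarrow> s"
    proof (rule tendsto_sandwich[where f = "\<lambda>_. s"])
      show "(\<lambda>n. s + h n) \<longlonglongrightarrow> s" using tendsto_add[OF tendsto_const h0, of s] by simp
    qed (use less_imp_le[OF gt] le in auto)
    then have "filterlim (\<lambda>n. r n s) (at_right s) sequentially"
      unfolding filterlim_at using gt by (auto simp: less_imp_neq[symmetric] intro!: always_eventually)
    then have "(\<lambda>n. f (r n s)) \<longlonglongrightarrow> f s"
      using f[of s] True by (auto intro: filterlim_compose)
    then show ?thesis using True by (simp add: g_in F_def)
  qed (simp add: g_out F_def)
  have g_meas [measurable]: "g n \<in> borel_measurable lborel" for n unfolding g_def by measurable
  have F_meas [measurable]: "F \<in> borel_measurable lborel"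
    by (rule borel_measurable_LIMSEQ_real[where u = g]) (use lim in auto)
  have bound: "norm (g n s) \<le> b * indicator {0..T} s" for n s
    using b[of "r n s"] b0 by (cases "s \<in> {0..<T}") (auto simp: g_in g_out indicator_def)
  have w: "integrable lborel (\<lambda>s. b * indicator {0..T} s :: real)"
    by (intro integrable_mult_right integrable_real_indicator) (auto simp: emeasure_lborel_Icc_eq)
  have dom: "integrable lborel F" "(\<lambda>n. LINT s|lborel. g n s) \<longlonglongrightarrow> (LINT s|lborel. F s)"
    using lim bound by (auto intro!: integrable_dominated_convergence[OF _ _ w, where s = g]
        integral_dominated_convergence[OF _ _ w])
  have fF: "indicator {0..T} s *\<^sub>R f s = F s + indicator {T} s *\<^sub>R f T" for s
    using T by (auto simp: F_def indicator_def)
  have pt: "has_bochner_integral lborel (\<lambda>s. indicator {T} s *\<^sub>R f T) 0"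
    using has_bochner_integral_indicator[of "{T}" lborel "f T"] by simp
  show "set_integrable lborel {0..T} f"
    unfolding set_integrable_def fF using dom(1) pt by (auto dest: integrable.intros)
  have eq: "(LINT s:{0..T}|lborel. f s) = (LINT s|lborel. F s)"
    unfolding set_lebesgue_integral_def fF using dom(1) pt by (simp add: has_bochner_integral_iff)
  have "(LINT s|lborel. g n s) = (\<Sum>i<Suc n. h n * f (real (Suc i) * h n))" for n
  proof -
    have "(LINT s|lborel. g n s)
       = (\<Sum>i<Suc n. LINT s|lborel. f (real (Suc i) * h n) * indicator {real i * h n..<real (Suc i) * h n} s)"
      unfolding g_def using h(1)[of n] by (intro Bochner_Integration.integral_sum) auto
    also have "\<dots> = (\<Sum>i<Suc n. h n * f (real (Suc i) * h n))"
      using h(1)[of n] by (intro sum.cong) (auto simp: algebra_simps)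
    finally show ?thesis .
  qed
  then show "(\<lambda>n. \<Sum>i<Suc n. T / real (Suc n) * f (real (Suc i) * (T / real (Suc n))))
         \<longlonglongrightarrow> (LINT s:{0..T}|lborel. f s)"
    using dom(2) unfolding eq h_def by simp
qed

lemma right_constant_tendsto:
  "eventually (\<lambda>s. x s = x t) (at_right t) \<Longrightarrow> ((\<lambda>s. V (x s)) \<longlongrightarrow> V (x t)) (at_right t)"
  by (rule tendsto_eventually) (auto elim: eventually_mono)

text \<open>A state outside \<open>B\<close> is occupied during a null set of times. There are countably many such
  states, so the path is in \<open>B\<close> at almost every time.\<close>

lemma occupation_formula:
  fixes x :: "real \<Rightarrow> 's::countable" and V :: "'s \<Rightarrow> real"
  assumes T: "0 < T" and x: "\<And>t. 0 \<le> t \<Longrightarrow> eventually (\<lambda>s. x s = x t) (at_right t)"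
    and B: "finite B" "\<And>z. z \<notin> B \<Longrightarrow> (LINT s:{0..T}|lborel. indicator {z} (x s)) = (0::real)"
    and V: "\<And>z. \<bar>V z\<bar> \<le> b"
  shows "(LINT s:{0..T}|lborel. V (x s)) = (\<Sum>z\<in>B. V z * (LINT s:{0..T}|lborel. indicator {z} (x s)))"
proof -
  have int: "set_integrable lborel {0..T} (\<lambda>s. W (x s))" if "\<And>z. \<bar>W z\<bar> \<le> b'" for W :: "'s \<Rightarrow> real" and b'
    by (rule set_integrable_right_continuous[OF T right_constant_tendsto[OF x] that])
  have int1: "set_integrable lborel {0..T} (\<lambda>s. indicator {z} (x s) :: real)" for z
    by (rule int[of "indicator {z}" 1]) (auto simp: indicator_def)
  have "AE s in lborel. indicator {0..T} s *\<^sub>R (indicator {z} (x s) :: real) = 0" if "z \<notin> B" for z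
    using B(2)[OF that] int1[of z] unfolding set_lebesgue_integral_def set_integrable_def
    by (subst (asm) integral_nonneg_eq_0_iff_AE) auto
  then have "AE s in lborel. \<forall>z\<in>-B. indicator {0..T} s *\<^sub>R (indicator {z} (x s) :: real) = 0"
    by (subst AE_ball_countable) auto
  then have ae: "AE s in lborel. indicator {0..T} s *\<^sub>R V (x s)
      = (\<Sum>z\<in>B. V z * (indicator {0..T} s *\<^sub>R indicator {z} (x s)))"
  proof eventually_elim
    case (elim s)
    show ?case
    proof (cases "s \<in> {0..T}")
      case True
      then have "x s \<in> B" using elim by (auto simp: indicator_def)
      then have "(\<Sum>z\<in>B. V z * indicator {z} (x s)) = V (x s)"
        using B(1) by (subst sum.remove[of _ "x s"]) (auto intro!: sum.neutral simp: indicator_def)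
      then show ?thesis using True by simp
    qed auto
  qed
  have "(LINT s:{0..T}|lborel. V (x s)) = (LINT s|lborel. (\<Sum>z\<in>B. V z * (indicator {0..T} s *\<^sub>R indicator {z} (x s))))"
    unfolding set_lebesgue_integral_def using ae int[OF V] int1
    by (intro integral_cong_AE) (auto simp: set_integrable_def intro!: borel_measurable_sum borel_measurable_times)
  also have "\<dots> = (\<Sum>z\<in>B. V z * (LINT s:{0..T}|lborel. indicator {z} (x s)))"
    unfolding set_lebesgue_integral_def using int1
    by (subst Bochner_Integration.integral_sum) (auto simp: set_integrable_def)
  finally show ?thesis .
qed

lemma local_time_nonneg: "0 \<le> local_time X T \<omega> z"
  unfolding local_time_def set_lebesgue_integral_def by (intro Bochner_Integration.integral_nonneg) auto

lemma sum_local_time: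
  fixes X :: "real \<Rightarrow> 'w \<Rightarrow> 's::countable"
  assumes "markov_chain M X A a" and T: "0 < T" and \<omega>: "\<omega> \<in> space M"
    and B: "finite B" "\<And>z. z \<notin> B \<Longrightarrow> local_time X T \<omega> z = 0"
  shows "(\<Sum>z\<in>B. local_time X T \<omega> z) = T"
proof -
  interpret markov_chain M X A a by fact
  have "(LINT s:{0..T}|lborel. (\<lambda>z. 1::real) (X s \<omega>)) = (\<Sum>z\<in>B. (\<lambda>z. 1) z * (LINT s:{0..T}|lborel. indicator {z} (X s \<omega>)))"
    by (rule occupation_formula[OF T right_continuous[OF _ \<omega>] B(1) B(2)[unfolded local_time_def], where b = 1]) auto
  then show ?thesis using T by (simp add: local_time_def set_integral_const)
qed

section \<open>The Feynman--Kac inequality\<close>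

lemma measurable_additive_functional:
  fixes X :: "real \<Rightarrow> 'w \<Rightarrow> 's::countable" and V :: "'s \<Rightarrow> real"
  assumes "markov_chain M X A a" and T: "0 < T" and V: "\<And>x. \<bar>V x\<bar> \<le> b"
  shows "(\<lambda>\<omega>. LINT s:{0..T}|lborel. V (X s \<omega>)) \<in> borel_measurable M"
proof -
  interpret markov_chain M X A a by fact
  have [measurable]: "X (real (Suc i) * (T / real (Suc n))) \<in> measurable M (count_space UNIV)" for i n
    using T by (intro measurable_state) auto
  have m: "(\<lambda>\<omega>. \<Sum>i<Suc n. T / real (Suc n) * V (X (real (Suc i) * (T / real (Suc n))) \<omega>)) \<in> borel_measurable M" for n
    by measurable
  show ?thesis
    by (rule borel_measurable_LIMSEQ_real[OF _ m],
        rule right_riemann_sums_LIMSEQ[OF T right_constant_tendsto[OF right_continuous] V])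
qed

text \<open>The discrete inequality involves left-end sums, the Riemann approximation right-end sums.
  The two differ by \<open>h (V(X\<^sub>T) - V(X\<^sub>0))\<close>, which disappears in the limit. Fatou's lemma suffices
  because only an upper bound is claimed.\<close>

lemma feynman_kac:
  fixes X :: "real \<Rightarrow> 'w \<Rightarrow> 's::countable"
  assumes mc: "markov_chain M X A a" and A: "row_bounded A c" and T: "0 < T"
    and u: "\<And>x. 1 \<le> u x" "\<And>x. u x \<le> b"
    and V: "\<And>x. V x = - matrix_apply A u x / u x"
  shows "(\<integral>\<^sup>+ \<omega>. ennreal (exp (LINT s:{0..T}|lborel. V (X s \<omega>)) * u (X T \<omega>)) \<partial>M) \<le> ennreal (u a)"
proof -
  interpret markov_chain M X A a by fact
  define h where "h n = T / real (Suc n)" for n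
  define S where "S n \<omega> = (\<Sum>i<Suc n. h n * V (X (real (Suc i) * h n) \<omega>))" for n \<omega>
  define C where "C = exp c * b * exp (c * b)"
  have b: "0 \<le> b" using u[of undefined] by linarith
  have u0: "0 \<le> u x" for x using u(1)[of x] by linarith
  have h: "0 < h n" "real (Suc n) * h n = T" for n using T by (auto simp: h_def)
  have h0: "h \<longlonglongrightarrow> 0" unfolding h_def
    using LIMSEQ_Suc[OF tendsto_mult_right_zero[OF lim_inverse_n, of T]] by (simp add: divide_inverse)
  have Vb: "\<bar>V x\<bar> \<le> c * b" for x by (rule abs_potential_le[OF A u V])
  have [measurable]: "X (real (Suc i) * h n) \<in> measurable M (count_space UNIV)" "X T \<in> measurable M (count_space UNIV)" for i n
    using T h(1)[of n] by (intro measurable_state; simp)+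
  have S_lim: "(\<lambda>n. S n \<omega>) \<longlonglongrightarrow> (LINT s:{0..T}|lborel. V (X s \<omega>))" if "\<omega> \<in> space M" for \<omega>
    unfolding S_def h_def
    by (rule right_riemann_sums_LIMSEQ[OF T right_constant_tendsto[OF right_continuous[OF _ that]] Vb])
  have step: "(\<integral>\<^sup>+ \<omega>. ennreal (exp (S n \<omega>) * u (X T \<omega>)) \<partial>M) \<le> ennreal (exp (h n * (2 * (c * b) + C * T)) * u a)"
    if "h n \<le> 1" for n
  proof -
    have "S n \<omega> \<le> h n * (2 * (c * b)) + h n * (\<Sum>i<Suc n. V (X (real i * h n) \<omega>))" for \<omega>
    proof -
      have "S n \<omega> - h n * (\<Sum>i<Suc n. V (X (real i * h n) \<omega>))
          = h n * (\<Sum>i<Suc n. V (X (real (Suc i) * h n) \<omega>) - V (X (real i * h n) \<omega>))"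
        unfolding S_def sum_subtractf right_diff_distrib sum_distrib_left ..
      also have "\<dots> = h n * (V (X (real (Suc n) * h n) \<omega>) - V (X (real 0 * h n) \<omega>))"
        by (simp only: sum_lessThan_telescope[of "\<lambda>i. V (X (real i * h n) \<omega>)"])
      also have "\<dots> \<le> h n * (2 * (c * b))"
        using h(1)[of n] Vb[of "X (real (Suc n) * h n) \<omega>"] Vb[of "X (real 0 * h n) \<omega>"]
        by (intro mult_left_mono) auto
      finally show ?thesis by simp
    qed
    then have "exp (S n \<omega>) * u (X T \<omega>) \<le> exp (h n * (2 * (c * b)) + h n * (\<Sum>i<Suc n. V (X (real i * h n) \<omega>))) * u (X T \<omega>)" for \<omega>
      by (intro mult_right_mono u0) simp
    then have "(\<integral>\<^sup>+ \<omega>. ennreal (exp (S n \<omega>) * u (X T \<omega>)) \<partial>M)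
       \<le> (\<integral>\<^sup>+ \<omega>. ennreal (exp (h n * (2 * (c * b)))) *
            ennreal (exp (h n * (\<Sum>i<Suc n. V (X (real i * h n) \<omega>))) * u (X (real (Suc n) * h n) \<omega>)) \<partial>M)"
      unfolding h(2) using u0 by (intro nn_integral_mono) (simp add: exp_add mult.assoc ennreal_leI flip: ennreal_mult)
    also have "\<dots> = ennreal (exp (h n * (2 * (c * b)))) *
        (\<integral>\<^sup>+ \<omega>. ennreal (exp (h n * (\<Sum>i<Suc n. V (X (real i * h n) \<omega>))) * u (X (real (Suc n) * h n) \<omega>)) \<partial>M)"
    proof (rule nn_integral_cmult)
      have [measurable]: "X (real i * h n) \<in> measurable M (count_space UNIV)" for i
        using h(1)[of n] by (intro measurable_state) simp
      show "(\<lambda>\<omega>. ennreal (exp (h n * (\<Sum>i<Suc n. V (X (real i * h n) \<omega>))) * u (X (real (Suc n) * h n) \<omega>))) \<in> borel_measurable M"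
        by measurable
    qed
    also have "\<dots> \<le> ennreal (exp (h n * (2 * (c * b)))) * ennreal ((1 + C * (h n)\<^sup>2) ^ Suc n * u a)"
      unfolding C_def by (intro mult_left_mono discrete_feynman_kac[OF mc A u V] less_imp_le[OF h(1)] that) auto
    also have "\<dots> = ennreal (exp (h n * (2 * (c * b))) * ((1 + C * (h n)\<^sup>2) ^ Suc n * u a))"
      using b u0 by (simp add: C_def flip: ennreal_mult)
    also have "\<dots> \<le> ennreal (exp (h n * (2 * (c * b))) * (exp (C * (h n)\<^sup>2) ^ Suc n * u a))"
      using b u0 by (intro ennreal_leI mult_left_mono mult_right_mono power_mono exp_ge_add_one_self) (auto simp: C_def)
    also have "exp (h n * (2 * (c * b))) * (exp (C * (h n)\<^sup>2) ^ Suc n * u a) = exp (h n * (2 * (c * b) + C * T)) * u a"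
    proof -
      have "real (Suc n) * (C * (h n)\<^sup>2) = h n * (C * T)"
        by (simp only: h(2)[of n, symmetric] power2_eq_square mult_ac)
      then have "exp (C * (h n)\<^sup>2) ^ Suc n = exp (h n * (C * T))"
        by (simp only: exp_of_nat_mult[symmetric])
      then show ?thesis by (simp only: distrib_left exp_add mult.assoc)
    qed
    finally show ?thesis .
  qed
  have lim: "(\<lambda>n. ennreal (exp (h n * (2 * (c * b) + C * T)) * u a)) \<longlonglongrightarrow> ennreal (exp (0 * (2 * (c * b) + C * T)) * u a)"
    by (intro tendsto_intros h0)
  have "(\<integral>\<^sup>+ \<omega>. ennreal (exp (LINT s:{0..T}|lborel. V (X s \<omega>)) * u (X T \<omega>)) \<partial>M)
      = (\<integral>\<^sup>+ \<omega>. liminf (\<lambda>n. ennreal (exp (S n \<omega>) * u (X T \<omega>))) \<partial>M)"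
  proof (intro nn_integral_cong)
    fix \<omega> assume "\<omega> \<in> space M"
    then have "(\<lambda>n. ennreal (exp (S n \<omega>) * u (X T \<omega>))) \<longlonglongrightarrow> ennreal (exp (LINT s:{0..T}|lborel. V (X s \<omega>)) * u (X T \<omega>))"
      by (intro tendsto_intros S_lim)
    then show "ennreal (exp (LINT s:{0..T}|lborel. V (X s \<omega>)) * u (X T \<omega>)) = liminf (\<lambda>n. ennreal (exp (S n \<omega>) * u (X T \<omega>)))"
      by (simp add: lim_imp_Liminf)
  qed
  also have "\<dots> \<le> liminf (\<lambda>n. \<integral>\<^sup>+ \<omega>. ennreal (exp (S n \<omega>) * u (X T \<omega>)) \<partial>M)"
    unfolding S_def by (intro nn_integral_liminf) measurable
  also have "\<dots> \<le> liminf (\<lambda>n. ennreal (exp (h n * (2 * (c * b) + C * T)) * u a))"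
  proof (rule Liminf_mono)
    have "eventually (\<lambda>n. h n < 1) sequentially" using order_tendstoD(2)[OF h0, of 1] by simp
    then show "\<forall>\<^sub>F n in sequentially. (\<integral>\<^sup>+ \<omega>. ennreal (exp (S n \<omega>) * u (X T \<omega>)) \<partial>M)
        \<le> ennreal (exp (h n * (2 * (c * b) + C * T)) * u a)"
      by eventually_elim (rule step, simp)
  qed
  also have "\<dots> = ennreal (u a)"
    using lim_imp_Liminf[OF _ lim] by simp
  finally show ?thesis .
qed

section \<open>Exponential moments of the Dirichlet form of the local times\<close>

text \<open>The function is restricted to \<open>B\<close>, so that for all \<open>\<nu>\<close> with values in the unit interval it
  belongs to one finite set of extensional functions.\<close>

definition rounded_root :: "'s set \<Rightarrow> real \<Rightarrow> ('s \<Rightarrow> real) \<Rightarrow> 's \<Rightarrow> nat" where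
  "rounded_root B T \<nu> = (\<lambda>x\<in>B. nat \<lfloor>T * sqrt (\<nu> x)\<rfloor>)"

text \<open>Adding one makes the function at least 1 everywhere, and outside \<open>B\<close> it takes the least such
  value.\<close>

definition step_up :: "'s set \<Rightarrow> ('s \<Rightarrow> nat) \<Rightarrow> 's \<Rightarrow> real" where
  "step_up B k x = (if x \<in> B then real (k x) + 1 else 1)"

text \<open>Let \<open>u\<close> be the rounded function. Since \<open>u(x) \<ge> T sqrt(\<nu>(x))\<close>, the weight \<open>\<nu>(x) / u(x)\<close> is at most
  \<open>sqrt(\<nu>(x)) / T\<close>; since \<open>u(y) \<le> T sqrt(\<nu>(y)) + 1\<close>, the off-diagonal part of \<open>A u(x)\<close> is at most
  \<open>T \<Sum>\<^sub>y A(x,y) sqrt(\<nu>(y))\<close> plus the total exit rate from \<open>x\<close>, which is at most \<open>c\<close>. The diagonal term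
  is \<open>A(x,x) \<nu>(x)\<close> whatever the rounding, so nothing is lost although \<open>A(x,x)\<close> may be negative.\<close>

lemma matrix_apply_rounded_root_le:
  assumes A: "row_bounded A c" and off: "\<And>x y. x \<noteq> y \<Longrightarrow> 0 \<le> A x y"
    and B: "finite B" and x: "x \<in> B" and T: "0 < T"
    and nu: "\<And>x. 0 \<le> \<nu> x" "\<nu> x \<le> 1"
  defines "u \<equiv> step_up B (rounded_root B T \<nu>)"
  shows "\<nu> x / u x * matrix_apply A u x \<le> (\<Sum>y\<in>B. sqrt (\<nu> x) * A x y * sqrt (\<nu> y)) + c / T"
proof -
  define exit_rate where "exit_rate = matrix_apply A (indicator (- {x})) x"
  have u_in: "T * sqrt (\<nu> y) \<le> u y" "u y \<le> T * sqrt (\<nu> y) + 1" if "y \<in> B" for y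
  proof -
    have "0 \<le> T * sqrt (\<nu> y)" using T nu(1)[of y] by simp
    then have "real (nat \<lfloor>T * sqrt (\<nu> y)\<rfloor>) = of_int \<lfloor>T * sqrt (\<nu> y)\<rfloor>" by simp
    then show "T * sqrt (\<nu> y) \<le> u y" "u y \<le> T * sqrt (\<nu> y) + 1"
      using that unfolding u_def step_up_def rounded_root_def by simp_all
  qed
  have u1: "1 \<le> u y" for y by (simp add: u_def step_up_def)
  have O_abs: "\<bar>exit_rate\<bar> \<le> c * 1"
    unfolding exit_rate_def by (rule abs_matrix_apply_le[OF A]) (simp add: indicator_def)
  have iO: "integrable (count_space UNIV) (\<lambda>y. A x y * indicator (- {x}) y)"
    by (rule integrable_row[OF A, where b = 1]) (simp add: indicator_def)
  have O0: "0 \<le> exit_rate"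
    unfolding exit_rate_def matrix_apply_def
    by (intro Bochner_Integration.integral_nonneg) (auto simp: indicator_def off)
  \<comment> \<open>The finitely supported part of a majorant of \<open>A x y * u y\<close>, whose remainder sums to the exit
    rate. At \<open>y = x\<close> it is exact, because there \<open>A x x\<close> may have any sign.\<close>
  define \<beta> where "\<beta> z = (if z = x then A x x * u x else A x z * (T * sqrt (\<nu> z)))" for z
  have ind: "has_bochner_integral (count_space UNIV) (\<lambda>y. indicator {z} y *\<^sub>R \<beta> z) (\<beta> z)" for z
    using has_bochner_integral_indicator[of "{z}" "count_space UNIV" "\<beta> z"] by simp
  have maj: "has_bochner_integral (count_space UNIV)
      (\<lambda>y. (\<Sum>z\<in>B. indicator {z} y *\<^sub>R \<beta> z) + A x y * indicator (- {x}) y) ((\<Sum>z\<in>B. \<beta> z) + exit_rate)"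
    unfolding exit_rate_def matrix_apply_def
    by (intro has_bochner_integral_add has_bochner_integral_sum ind has_bochner_integral_integrable iO)
  have sB: "(\<Sum>z\<in>B. indicator {z} y *\<^sub>R \<beta> z) = (if y \<in> B then \<beta> y else 0)" for y
  proof -
    have "(\<Sum>z\<in>B. indicator {z} y *\<^sub>R \<beta> z) = (\<Sum>z\<in>B. if y = z then \<beta> z else 0)"
      by (intro sum.cong) (auto simp: indicator_def)
    then show ?thesis using B by simp
  qed
  have "matrix_apply A u x \<le> (\<Sum>z\<in>B. \<beta> z) + exit_rate"
  proof -
    have fin: "finite (range u)" 
    proof -
      have "range u \<subseteq> insert 1 (u ` B)" by (auto simp: u_def step_up_def)
      then show ?thesis using B by (meson finite_imageI finite_insert finite_subset)
    qed
    have "\<bar>u y\<bar> \<le> Max (range u)" for y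
      using Max_ge[OF fin, of "u y"] u1[of y] by auto
    then have iu: "integrable (count_space UNIV) (\<lambda>y. A x y * u y)"
      by (rule integrable_row[OF A])
    have "matrix_apply A u x \<le> (LINT y|count_space UNIV. (\<Sum>z\<in>B. indicator {z} y *\<^sub>R \<beta> z) + A x y * indicator (- {x}) y)"
      unfolding matrix_apply_def
    proof (intro integral_mono iu)
      show "integrable (count_space UNIV) (\<lambda>y. (\<Sum>z\<in>B. indicator {z} y *\<^sub>R \<beta> z) + A x y * indicator (- {x}) y)"
        using maj by (rule integrable.intros)
      fix y
      show "A x y * u y \<le> (\<Sum>z\<in>B. indicator {z} y *\<^sub>R \<beta> z) + A x y * indicator (- {x}) y"
      proof (cases "y = x")
        case True
        then show ?thesis unfolding sB using x by (simp add: \<beta>_def)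
      next
        case False
        have "u y \<le> (if y \<in> B then T * sqrt (\<nu> y) else 0) + 1"
          using u_in(2)[of y] by (auto simp: u_def step_up_def)
        then have "A x y * u y \<le> A x y * ((if y \<in> B then T * sqrt (\<nu> y) else 0) + 1)"
          using off[of x y] False by (intro mult_left_mono) auto
        then show ?thesis unfolding sB using False by (auto simp: \<beta>_def algebra_simps)
      qed
    qed
    then show ?thesis using maj by (simp add: has_bochner_integral_iff)
  qed
  also have "(\<Sum>z\<in>B. \<beta> z) = A x x * u x + T * (\<Sum>z\<in>B-{x}. A x z * sqrt (\<nu> z))"
    using B x by (simp add: sum.remove[of B x] \<beta>_def sum_distrib_left mult_ac)
  finally have up: "matrix_apply A u x \<le> A x x * u x + (T * (\<Sum>z\<in>B-{x}. A x z * sqrt (\<nu> z)) + exit_rate)"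
    by simp
  have ux: "0 < u x" using u1[of x] by linarith
  have a: "\<nu> x / u x \<le> sqrt (\<nu> x) / T"
  proof -
    have "\<nu> x * T = sqrt (\<nu> x) * (T * sqrt (\<nu> x))" using nu(1)[of x] by simp
    also have "\<dots> \<le> sqrt (\<nu> x) * u x" using u_in(1)[OF x] nu(1)[of x] by (intro mult_left_mono) auto
    finally show ?thesis using ux T by (simp add: pos_divide_le_eq pos_le_divide_eq field_simps)
  qed
  have S0: "0 \<le> T * (\<Sum>z\<in>B-{x}. A x z * sqrt (\<nu> z)) + exit_rate"
    using T O0 nu(1) off by (intro add_nonneg_nonneg mult_nonneg_nonneg sum_nonneg) auto
  have "\<nu> x / u x * matrix_apply A u x \<le> \<nu> x / u x * (A x x * u x + (T * (\<Sum>z\<in>B-{x}. A x z * sqrt (\<nu> z)) + exit_rate))"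
    using ux nu(1)[of x] by (intro mult_left_mono up) auto
  also have "\<dots> = A x x * \<nu> x + \<nu> x / u x * (T * (\<Sum>z\<in>B-{x}. A x z * sqrt (\<nu> z)) + exit_rate)"
    using ux by (simp add: distrib_left)
  also have "\<dots> \<le> A x x * \<nu> x + sqrt (\<nu> x) / T * (T * (\<Sum>z\<in>B-{x}. A x z * sqrt (\<nu> z)) + exit_rate)"
    by (intro add_left_mono mult_right_mono a S0)
  also have "\<dots> = A x x * \<nu> x + sqrt (\<nu> x) * (\<Sum>z\<in>B-{x}. A x z * sqrt (\<nu> z)) + sqrt (\<nu> x) * exit_rate / T"
    using T by (simp add: field_simps)
  also have "\<dots> \<le> A x x * \<nu> x + sqrt (\<nu> x) * (\<Sum>z\<in>B-{x}. A x z * sqrt (\<nu> z)) + c / T"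
  proof -
    have "sqrt (\<nu> x) * exit_rate \<le> 1 * c"
      using nu(1)[of x] nu(2) O0 O_abs by (intro mult_mono) auto
    then show ?thesis using T by (simp add: divide_right_mono)
  qed
  also have "A x x * \<nu> x + sqrt (\<nu> x) * (\<Sum>z\<in>B-{x}. A x z * sqrt (\<nu> z))
     = (\<Sum>y\<in>B. sqrt (\<nu> x) * A x y * sqrt (\<nu> y))"
    using B x nu(1)[of x] by (subst sum.remove[of B x]) (auto simp: sum_distrib_left mult_ac real_sqrt_mult_self)
  finally show ?thesis .
qed

text \<open>Minus the double sum is \<open>I(\<nu>)\<close>. Whatever the path, its own rounded function is among the
  finitely many functions of the family \<open>K\<close>, so \<open>exp(T I(\<nu>))\<close> is bounded by the sum of
  the Feynman--Kac functionals over all of \<open>K\<close>, up to the rounding error \<open>exp(c |B|)\<close>.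
  The size of \<open>K\<close> is the entropy that has to be negligible.\<close>

theorem exp_dirichlet_form_local_times_le:
  fixes X :: "real \<Rightarrow> 'w \<Rightarrow> 's::countable"
  assumes mc: "markov_chain M X A a" and A: "row_bounded A c"
    and off: "\<And>x y. x \<noteq> y \<Longrightarrow> 0 \<le> A x y"
    and B: "finite B" and T: "0 < T"
  defines "\<nu> \<equiv> \<lambda>\<omega> z. local_time X T \<omega> z / T"
  shows "(\<integral>\<^sup>+ \<omega>. ennreal (exp (- T * (\<Sum>x\<in>B. \<Sum>y\<in>B. sqrt (\<nu> \<omega> x) * A x y * sqrt (\<nu> \<omega> y))))
            * indicator {\<omega>. \<forall>z. z \<notin> B \<longrightarrow> local_time X T \<omega> z = 0} \<omega> \<partial>M)
      \<le> ennreal (exp (c * card B) * (T + 1) ^ (card B + 1))"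
proof -
  interpret markov_chain M X A a by fact
  define K where "K = (\<Pi>\<^sub>E x\<in>B. {..nat \<lfloor>T\<rfloor>})"
  define u where "u = step_up B"
  define V where "V k x = - matrix_apply A (u k) x / u k x" for k x
  define Z where "Z k \<omega> = ennreal (exp (LINT s:{0..T}|lborel. V k (X s \<omega>)) * u k (X T \<omega>))" for k \<omega>
  have finK: "finite K" unfolding K_def using B by (intro finite_PiE) auto
  have u1: "1 \<le> u k x" for k x by (simp add: u_def step_up_def)
  have uT: "u k x \<le> T + 1" if "k \<in> K" for k x
  proof (cases "x \<in> B")
    case True
    then have "k x \<le> nat \<lfloor>T\<rfloor>" using that by (auto simp: K_def PiE_iff)
    then have "real (k x) \<le> T" using T by linarith
    then show ?thesis by (simp add: u_def step_up_def)
  qed (use T in \<open>simp add: u_def step_up_def\<close>)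
  have Vb: "\<bar>V k x\<bar> \<le> c * (T + 1)" if "k \<in> K" for k x
    by (rule abs_potential_le[OF A u1 uT[OF that]]) (simp add: V_def)
  have Z_meas: "Z k \<in> borel_measurable M" if "k \<in> K" for k
  proof -
    have [measurable]: "(\<lambda>\<omega>. LINT s:{0..T}|lborel. V k (X s \<omega>)) \<in> borel_measurable M"
      by (rule measurable_additive_functional[OF mc T Vb[OF that]])
    have [measurable]: "X T \<in> measurable M (count_space UNIV)" using T by (intro measurable_state) simp
    show ?thesis unfolding Z_def by measurable
  qed
  have Z_int: "(\<integral>\<^sup>+ \<omega>. Z k \<omega> \<partial>M) \<le> ennreal (T + 1)" if "k \<in> K" for k
  proof -
    have "(\<integral>\<^sup>+ \<omega>. Z k \<omega> \<partial>M) \<le> ennreal (u k a)"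
      unfolding Z_def by (rule feynman_kac[OF mc A T u1 uT[OF that]]) (simp add: V_def)
    then show ?thesis using uT[OF that, of a] by (meson ennreal_leI order_trans)
  qed
  have ptw: "ennreal (exp (- T * (\<Sum>x\<in>B. \<Sum>y\<in>B. sqrt (\<nu> \<omega> x) * A x y * sqrt (\<nu> \<omega> y))))
     \<le> ennreal (exp (c * card B)) * (\<Sum>k\<in>K. Z k \<omega>)"
    if \<omega>: "\<omega> \<in> space M" and zero: "\<And>z. z \<notin> B \<Longrightarrow> local_time X T \<omega> z = 0" for \<omega>
  proof -
    define k where "k = rounded_root B T (\<nu> \<omega>)"
    have nu0: "0 \<le> \<nu> \<omega> z" for z using T by (simp add: \<nu>_def local_time_nonneg)
    have "(\<Sum>z\<in>B. \<nu> \<omega> z) = 1"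
      using sum_local_time[OF mc T \<omega> B zero] T by (simp add: \<nu>_def flip: sum_divide_distrib)
    then have nu1: "\<nu> \<omega> z \<le> 1" if "z \<in> B" for z
      using member_le_sum[OF that, of "\<nu> \<omega>"] nu0 B by auto
    have kK: "k \<in> K"
    proof -
      have "nat \<lfloor>T * sqrt (\<nu> \<omega> z)\<rfloor> \<le> nat \<lfloor>T\<rfloor>" if "z \<in> B" for z
      proof -
        have "T * sqrt (\<nu> \<omega> z) \<le> T * 1" using nu1[OF that] T by (intro mult_left_mono) auto
        then show ?thesis by (intro nat_mono floor_mono) simp
      qed
      then show ?thesis unfolding k_def rounded_root_def K_def by auto
    qed
    have row: "\<nu> \<omega> x / u k x * matrix_apply A (u k) x \<le> (\<Sum>y\<in>B. sqrt (\<nu> \<omega> x) * A x y * sqrt (\<nu> \<omega> y)) + c / T"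
      if "x \<in> B" for x
      unfolding u_def k_def by (rule matrix_apply_rounded_root_le[where \<nu> = "\<nu> \<omega>", OF A off B that T nu0 nu1[OF that]])
    have "(LINT s:{0..T}|lborel. V k (X s \<omega>)) = (\<Sum>z\<in>B. V k z * local_time X T \<omega> z)"
      unfolding local_time_def
      by (rule occupation_formula[OF T right_continuous[OF _ \<omega>] B zero[unfolded local_time_def] Vb[OF kK]])
    also have "\<dots> = - T * (\<Sum>x\<in>B. \<nu> \<omega> x / u k x * matrix_apply A (u k) x)"
      using T by (simp add: V_def \<nu>_def sum_distrib_left sum_negf mult_ac)
    finally have int: "(LINT s:{0..T}|lborel. V k (X s \<omega>)) = - T * (\<Sum>x\<in>B. \<nu> \<omega> x / u k x * matrix_apply A (u k) x)" .
    have "T * (\<Sum>x\<in>B. \<nu> \<omega> x / u k x * matrix_apply A (u k) x)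
       \<le> T * (\<Sum>x\<in>B. (\<Sum>y\<in>B. sqrt (\<nu> \<omega> x) * A x y * sqrt (\<nu> \<omega> y)) + c / T)"
      using T by (intro mult_left_mono sum_mono row) auto
    also have "\<dots> = T * (\<Sum>x\<in>B. \<Sum>y\<in>B. sqrt (\<nu> \<omega> x) * A x y * sqrt (\<nu> \<omega> y)) + c * card B"
      using T by (simp add: sum.distrib distrib_left)
    finally have "- T * (\<Sum>x\<in>B. \<Sum>y\<in>B. sqrt (\<nu> \<omega> x) * A x y * sqrt (\<nu> \<omega> y))
       \<le> c * card B + (LINT s:{0..T}|lborel. V k (X s \<omega>))"
      unfolding int by simp
    then have "exp (- T * (\<Sum>x\<in>B. \<Sum>y\<in>B. sqrt (\<nu> \<omega> x) * A x y * sqrt (\<nu> \<omega> y)))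
       \<le> exp (c * card B) * exp (LINT s:{0..T}|lborel. V k (X s \<omega>)) * 1"
      by (simp flip: exp_add)
    also have "\<dots> \<le> exp (c * card B) * exp (LINT s:{0..T}|lborel. V k (X s \<omega>)) * u k (X T \<omega>)"
      by (intro mult_left_mono u1) auto
    finally have "ennreal (exp (- T * (\<Sum>x\<in>B. \<Sum>y\<in>B. sqrt (\<nu> \<omega> x) * A x y * sqrt (\<nu> \<omega> y))))
       \<le> ennreal (exp (c * card B)) * Z k \<omega>"
      unfolding Z_def by (simp add: ennreal_leI mult.assoc flip: ennreal_mult')
    also have "\<dots> \<le> ennreal (exp (c * card B)) * (\<Sum>k\<in>K. Z k \<omega>)"
      using member_le_sum[OF kK, of "\<lambda>k. Z k \<omega>"] finK by (intro mult_left_mono) auto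
    finally show ?thesis .
  qed
  have "(\<integral>\<^sup>+ \<omega>. ennreal (exp (- T * (\<Sum>x\<in>B. \<Sum>y\<in>B. sqrt (\<nu> \<omega> x) * A x y * sqrt (\<nu> \<omega> y))))
            * indicator {\<omega>. \<forall>z. z \<notin> B \<longrightarrow> local_time X T \<omega> z = 0} \<omega> \<partial>M)
      \<le> (\<integral>\<^sup>+ \<omega>. ennreal (exp (c * card B)) * (\<Sum>k\<in>K. Z k \<omega>) \<partial>M)"
    using ptw by (intro nn_integral_mono) (auto simp: indicator_def)
  also have "\<dots> = ennreal (exp (c * card B)) * (\<Sum>k\<in>K. \<integral>\<^sup>+ \<omega>. Z k \<omega> \<partial>M)"
    using Z_meas by (simp add: nn_integral_cmult nn_integral_sum borel_measurable_sum)
  also have "\<dots> \<le> ennreal (exp (c * card B)) * (\<Sum>k\<in>K. ennreal (T + 1))"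
    by (intro mult_left_mono sum_mono Z_int) auto
  also have "\<dots> = ennreal (exp (c * card B) * (real (card K) * (T + 1)))"
  proof -
    have "(\<Sum>k\<in>K. ennreal (T + 1)) = ennreal (real (card K) * (T + 1))"
      using T by (subst sum_ennreal) auto
    then show ?thesis using T by (simp only:) (rule ennreal_mult[symmetric], auto)
  qed
  also have "\<dots> \<le> ennreal (exp (c * card B) * ((T + 1) ^ card B * (T + 1)))"
  proof (intro ennreal_leI mult_left_mono mult_right_mono)
    have "real (card K) = (real (nat \<lfloor>T\<rfloor>) + 1) ^ card B"
      unfolding K_def using B by (simp add: card_PiE add.commute)
    also have "\<dots> \<le> (T + 1) ^ card B" using T by (intro power_mono) auto
    finally show "real (card K) \<le> (T + 1) ^ card B" .
  qed (use T in auto)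
  finally show ?thesis by (simp add: mult_ac)
qed

section \<open>Nearest neighbours and the Dirichlet form of simple random walk\<close>

lemma nearest_neighbours_commute: "nearest_neighbours x y \<longleftrightarrow> nearest_neighbours y x"
  by (simp add: nearest_neighbours_def abs_minus_commute)

lemma not_nearest_neighbours_refl [simp]: "\<not> nearest_neighbours x x"
  by (simp add: nearest_neighbours_def)

lemma nearest_neighbours_subset:
  fixes x :: "int ^ 'd::finite"
  shows "{y. nearest_neighbours x y} \<subseteq> (\<lambda>(i, s). x + axis i s) ` (UNIV \<times> {1, - 1})"
proof
  fix y assume "y \<in> {y. nearest_neighbours x y}"
  then have s: "(\<Sum>i\<in>UNIV. \<bar>x $ i - y $ i\<bar>) = 1" by (simp add: nearest_neighbours_def)
  have "\<exists>i. \<bar>x $ i - y $ i\<bar> \<noteq> 0"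
  proof (rule ccontr)
    assume "\<nexists>i. \<bar>x $ i - y $ i\<bar> \<noteq> 0"
    then have "(\<Sum>i\<in>UNIV. \<bar>x $ i - y $ i\<bar>) = 0" by (intro sum.neutral) auto
    then show False using s by simp
  qed
  then obtain i where i: "\<bar>x $ i - y $ i\<bar> \<noteq> 0" by blast
  have split: "(\<Sum>j\<in>UNIV. \<bar>x $ j - y $ j\<bar>) = \<bar>x $ i - y $ i\<bar> + (\<Sum>j\<in>UNIV-{i}. \<bar>x $ j - y $ j\<bar>)"
    by (rule sum.remove) auto
  have rest0: "0 \<le> (\<Sum>j\<in>UNIV-{i}. \<bar>x $ j - y $ j\<bar>)" by (intro sum_nonneg) auto
  have "(\<Sum>j\<in>UNIV-{i}. \<bar>x $ j - y $ j\<bar>) = 0" and one: "\<bar>x $ i - y $ i\<bar> = 1"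
    using s split rest0 i by linarith+
  then have "\<forall>j\<in>UNIV-{i}. \<bar>x $ j - y $ j\<bar> = 0"
    by (subst (asm) sum_nonneg_eq_0_iff) auto
  then have "y = (\<lambda>(i, s). x + axis i s) (i, y $ i - x $ i)"
    by (auto simp: vec_eq_iff axis_def)
  moreover have "(i, y $ i - x $ i) \<in> UNIV \<times> {1, - 1}" using one by auto
  ultimately show "y \<in> (\<lambda>(i, s). x + axis i s) ` (UNIV \<times> {1, - 1})"
    by (rule image_eqI)
qed

lemma finite_nearest_neighbours: "finite {y. nearest_neighbours x (y :: int ^ 'd::finite)}"
  by (rule finite_subset[OF nearest_neighbours_subset]) auto

lemma card_nearest_neighbours_le:
  "card {y. nearest_neighbours x (y :: int ^ 'd::finite)} \<le> 2 * CARD('d)"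
proof -
  have "card {y. nearest_neighbours x y} \<le> card ((\<lambda>(i, s). x + axis i s) ` ((UNIV :: 'd set) \<times> {1, - 1 :: int}))"
    by (rule card_mono[OF _ nearest_neighbours_subset]) auto
  also have "\<dots> \<le> card ((UNIV :: 'd set) \<times> {1, - 1 :: int})" by (rule card_image_le) auto
  finally show ?thesis by simp
qed

lemma row_bounded_srw_generator: "row_bounded (srw_generator :: int ^ 'd::finite \<Rightarrow> _) (2 * real CARD('d))"
  unfolding row_bounded_def
proof (intro conjI allI)
  fix x :: "int ^ 'd"
  let ?N = "{y. nearest_neighbours x y}"
  have "(\<integral>\<^sup>+ y. ennreal \<bar>srw_generator x y\<bar> \<partial>count_space UNIV) = (\<Sum>y\<in>insert x ?N. ennreal \<bar>srw_generator x y\<bar>)"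
    using finite_nearest_neighbours by (intro nn_integral_count_space') (auto simp: srw_generator_def)
  also have "\<dots> = ennreal (\<Sum>y\<in>insert x ?N. \<bar>srw_generator x y\<bar>)"
    by (rule sum_ennreal) auto
  also have "(\<Sum>y\<in>insert x ?N. \<bar>srw_generator x y\<bar>) = real CARD('d) + real (card ?N) / 2"
    using finite_nearest_neighbours[of x] by (simp add: srw_generator_def)
  also have "\<dots> \<le> 2 * real CARD('d)" using card_nearest_neighbours_le[of x] by linarith
  finally show "(\<integral>\<^sup>+ y. ennreal \<bar>srw_generator x y\<bar> \<partial>count_space UNIV) \<le> ennreal (2 * real CARD('d))"
    by (simp add: ennreal_leI)
qed simp

text \<open>Expanding the square, each squared value of \<open>g\<close> is counted once for every neighbour, and there
  are at most \<open>2 d\<close> of them; this matches the diagonal entry \<open>- d\<close> of the generator. The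
  sum over edges is finite, because only edges with an end in \<open>B\<close> contribute.\<close>

lemma sum_edges_le_dirichlet_form:
  fixes g :: "int ^ 'd::finite \<Rightarrow> real"
  assumes B: "finite B" and g: "\<And>x. x \<notin> B \<Longrightarrow> g x = 0"
  shows "1/2 * sum_edges (\<lambda>x y. (g x - g y)\<^sup>2) \<le> - (\<Sum>x\<in>B. \<Sum>y\<in>B. g x * srw_generator x y * g y)"
proof -
  define N where "N x = {y. nearest_neighbours x y}" for x :: "int ^ 'd"
  have gB: "x \<in> B" if "g x \<noteq> 0" for x using g that by blast
  have N: "finite (N x)" "real (card (N x)) \<le> 2 * real CARD('d)" for x
    using finite_nearest_neighbours[of x] card_nearest_neighbours_le[of x] by (simp_all add: N_def)
  define B' where "B' = B \<union> (\<Union>x\<in>B. N x)"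
  define E where "E = (SIGMA x:B'. B' \<inter> N x)"
  have B': "finite B'" "B \<subseteq> B'" unfolding B'_def using B N by auto
  have E: "finite E" unfolding E_def using B' by auto
  have E_swap: "prod.swap ` E = E"
    by (auto simp: E_def N_def nearest_neighbours_commute image_iff)
  have "(\<Sum>\<^sub>\<infinity>(x, y)\<in>{(x, y). nearest_neighbours x y}. (g x - g y)\<^sup>2) = (\<Sum>\<^sub>\<infinity>(x, y)\<in>E. (g x - g y)\<^sup>2)"
  proof (rule infsum_cong_neutral)
    fix p assume "p \<in> {(x, y). nearest_neighbours x y} - E"
    then obtain x y where p: "p = (x, y)" and nn: "nearest_neighbours x y" "nearest_neighbours y x"
      and out: "x \<in> B' \<longrightarrow> y \<notin> B'"
      using nearest_neighbours_commute by (auto simp: E_def N_def)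
    have "x \<notin> B" "y \<notin> B"
      using nn out by (auto simp: B'_def N_def)
    then show "(case p of (x, y) \<Rightarrow> (g x - g y)\<^sup>2) = 0" by (simp add: p g)
  qed (auto simp: E_def N_def)
  also have "\<dots> = (\<Sum>(x, y)\<in>E. (g x - g y)\<^sup>2)" using E by simp
  also have "\<dots> = (\<Sum>(x, y)\<in>E. (g x)\<^sup>2) + (\<Sum>(x, y)\<in>E. (g y)\<^sup>2) - 2 * (\<Sum>(x, y)\<in>E. g x * g y)"
    by (simp add: power2_diff case_prod_unfold sum.distrib sum_subtractf sum_distrib_left mult.assoc)
  also have "(\<Sum>(x, y)\<in>E. (g y)\<^sup>2) = (\<Sum>(x, y)\<in>E. (g x)\<^sup>2)"
    by (subst E_swap[symmetric], subst sum.reindex) (auto simp: case_prod_unfold)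
  also have "(\<Sum>(x, y)\<in>E. g x * g y) = (\<Sum>x\<in>B. \<Sum>y\<in>B \<inter> N x. g x * g y)"
  proof -
    have "(\<Sum>(x, y)\<in>E. g x * g y) = (\<Sum>(x, y)\<in>(SIGMA x:B. B \<inter> N x). g x * g y)"
      by (rule sum.mono_neutral_right[OF E]) (use B' gB in \<open>auto simp: E_def\<close>)
    then show ?thesis using B N by (simp add: sum.Sigma)
  qed
  finally have inf: "(\<Sum>\<^sub>\<infinity>(x, y)\<in>{(x, y). nearest_neighbours x y}. (g x - g y)\<^sup>2)
     = 2 * (\<Sum>(x, y)\<in>E. (g x)\<^sup>2) - 2 * (\<Sum>x\<in>B. \<Sum>y\<in>B \<inter> N x. g x * g y)"
    by simp
  have "(\<Sum>(x, y)\<in>E. (g x)\<^sup>2) = (\<Sum>x\<in>B'. real (card (B' \<inter> N x)) * (g x)\<^sup>2)"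
    unfolding E_def using B' by (subst sum.Sigma[symmetric]) auto
  also have "\<dots> \<le> (\<Sum>x\<in>B'. 2 * real CARD('d) * (g x)\<^sup>2)"
  proof (intro sum_mono mult_right_mono)
    fix x
    have "card (B' \<inter> N x) \<le> card (N x)" using N by (intro card_mono) auto
    then show "real (card (B' \<inter> N x)) \<le> 2 * real CARD('d)" using N(2)[of x] by linarith
  qed auto
  also have "\<dots> = (\<Sum>x\<in>B. 2 * real CARD('d) * (g x)\<^sup>2)"
    by (rule sum.mono_neutral_right) (use B' g in auto)
  finally have sq: "(\<Sum>(x, y)\<in>E. (g x)\<^sup>2) \<le> 2 * real CARD('d) * (\<Sum>x\<in>B. (g x)\<^sup>2)"
    by (simp add: sum_distrib_left)
  have "(\<Sum>y\<in>B. g x * srw_generator x y * g y) = 1/2 * (\<Sum>y\<in>B \<inter> N x. g x * g y) - real CARD('d) * (g x)\<^sup>2"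
    if x: "x \<in> B" for x
  proof -
    have "(\<Sum>y\<in>B. g x * srw_generator x y * g y)
       = (\<Sum>y\<in>B. (if y \<in> N x then 1/2 * (g x * g y) else 0) + (if y = x then - real CARD('d) * (g x)\<^sup>2 else 0))"
      by (intro sum.cong) (auto simp: srw_generator_def N_def power2_eq_square)
    also have "\<dots> = (\<Sum>y\<in>B. if y \<in> N x then 1/2 * (g x * g y) else 0) - real CARD('d) * (g x)\<^sup>2"
      using B x by (simp add: sum.distrib)
    also have "(\<Sum>y\<in>B. if y \<in> N x then 1/2 * (g x * g y) else 0) = 1/2 * (\<Sum>y\<in>B \<inter> N x. g x * g y)"
      by (simp only: sum.inter_restrict[OF B, symmetric] sum_distrib_left)
    finally show ?thesis .
  qed
  then have "(\<Sum>x\<in>B. \<Sum>y\<in>B. g x * srw_generator x y * g y)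
      = 1/2 * (\<Sum>x\<in>B. \<Sum>y\<in>B \<inter> N x. g x * g y) - real CARD('d) * (\<Sum>x\<in>B. (g x)\<^sup>2)"
    by (simp add: sum_subtractf sum_distrib_left)
  then show ?thesis using sq unfolding sum_edges_def inf by (simp add: algebra_simps)
qed

section \<open>Rescaled local times\<close>

lemma
  fixes r :: real
  assumes r: "0 \<le> r"
  shows finite_lattice_cube: "finite (lattice_cube r :: (int ^ 'd::finite) set)"
    and card_lattice_cube_le: "real (card (lattice_cube r :: (int ^ 'd::finite) set)) \<le> (2 * r + 1) ^ CARD('d)"
proof -
  define P where "P = (\<Pi>\<^sub>E i\<in>(UNIV :: 'd set). {- \<lfloor>r\<rfloor>..\<lfloor>r\<rfloor>})"
  have P: "finite P" unfolding P_def by (intro finite_PiE) auto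
  have sub: "(lattice_cube r :: (int ^ 'd) set) \<subseteq> vec_lambda ` P"
  proof
    fix z :: "int ^ 'd" assume z: "z \<in> lattice_cube r"
    have "- \<lfloor>r\<rfloor> \<le> z $ i \<and> z $ i \<le> \<lfloor>r\<rfloor>" for i
    proof -
      have "real_of_int (- (z $ i)) \<le> r" "real_of_int (z $ i) \<le> r"
        using z by (auto simp: lattice_cube_def minus_le_iff)
      then have "- (z $ i) \<le> \<lfloor>r\<rfloor>" "z $ i \<le> \<lfloor>r\<rfloor>" by (simp_all only: le_floor_iff)
      then show ?thesis by linarith
    qed
    then show "z \<in> vec_lambda ` P"
      by (intro image_eqI[of _ _ "vec_nth z"]) (auto simp: P_def)
  qed
  show "finite (lattice_cube r :: (int ^ 'd) set)" using sub P by (meson finite_imageI finite_subset)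
  have "card (lattice_cube r :: (int ^ 'd) set) \<le> card (vec_lambda ` P :: (int ^ 'd) set)" using sub P by (intro card_mono) auto
  also have "\<dots> \<le> card P" using P by (rule card_image_le)
  finally have "real (card (lattice_cube r :: (int ^ 'd) set)) \<le> real (card P)" by simp
  also have "\<dots> = real (nat (2 * \<lfloor>r\<rfloor> + 1)) ^ CARD('d)" by (simp add: P_def card_PiE)
  also have "\<dots> \<le> (2 * r + 1) ^ CARD('d)" using r by (intro power_mono) linarith+
  finally show "real (card (lattice_cube r :: (int ^ 'd) set)) \<le> (2 * r + 1) ^ CARD('d)" .
qed

lemma rescaled_local_time_eq_rescaled_density:
  "rescaled_local_time X \<alpha> T \<omega> = rescaled_density (\<alpha> T) (\<lambda>z. local_time X T \<omega> z / T)"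
  by (simp add: fun_eq_iff rescaled_local_time_def rescaled_density_def)

text \<open>The point \<open>z / a\<close> belongs to the cell on which the rescaled density has the value \<open>a\<^sup>d \<mu>(z)\<close>.\<close>

lemma supp_rescaled_density_imp:
  assumes a: "0 < a" and supp: "supp (rescaled_density a \<mu>) \<subseteq> cube R" and z: "\<mu> z \<noteq> 0"
  shows "z \<in> lattice_cube (R * a)"
proof -
  define x where "x = (\<chi> i. real_of_int (z $ i) / a)"
  have "floor_vec (a *\<^sub>R x) = z" using a by (simp add: floor_vec_def x_def vec_eq_iff)
  then have "x \<in> {x. rescaled_density a \<mu> x \<noteq> 0}" using a z by (simp add: rescaled_density_def)
  then have "x \<in> cube R" using supp closure_subset[of "{x. rescaled_density a \<mu> x \<noteq> 0}"] unfolding supp_def by (meson subsetD)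
  then have "- R \<le> real_of_int (z $ i) / a \<and> real_of_int (z $ i) / a \<le> R" for i
    by (simp add: cube_def x_def)
  then have "- R * a \<le> real_of_int (z $ i) \<and> real_of_int (z $ i) \<le> R * a" for i
    using a by (simp only: pos_le_divide_eq pos_divide_le_eq)
  then show ?thesis by (simp add: lattice_cube_def)
qed

section \<open>The upper bound\<close>

lemma log_ennreal_le:
  assumes "e \<le> ennreal b" and "0 < b"
  shows "log_ennreal e \<le> ereal (ln b)"
proof (cases "e = 0")
  case False
  have fin: "e < \<infinity>" by (rule le_less_trans[OF assms(1)]) simp
  then have "0 < enn2real e" using False by (simp add: enn2real_positive_iff zero_less_iff_neq_zero)
  moreover have "enn2real e \<le> b" using assms by (simp add: enn2real_leI)
  ultimately show ?thesis using fin False by (simp add: log_ennreal_def)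
qed (simp add: log_ennreal_def)

text \<open>The assumption on \<open>F\<close> is applied to \<open>\<mu> = \<ell>\<^sub>T / T\<close> for each path separately and leaves only
  the exponential moment of the Dirichlet form.\<close>

lemma exp_moment_rescaled_local_times_le:
  fixes X :: "real \<Rightarrow> 'w \<Rightarrow> int ^ 'd::finite" and F :: "(real ^ 'd \<Rightarrow> real) \<Rightarrow> real"
  assumes walk: "simple_random_walk M X" and T: "0 < T" and a: "0 < \<alpha> T" and R: "0 < R"
    and F: "\<And>\<mu>. \<mu> \<in> lattice_prob_measures R (\<alpha> T) \<Longrightarrow>
      c \<le> (\<alpha> T)\<^sup>2 * (1/2 * sum_edges (\<lambda>x y. (sqrt (\<mu> x) - sqrt (\<mu> y))\<^sup>2)) - F (rescaled_density (\<alpha> T) \<mu>)"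
  defines "N \<equiv> card (lattice_cube (R * \<alpha> T) :: (int ^ 'd) set)"
  shows "(\<integral>\<^sup>+ \<omega>. ennreal (exp (T / (\<alpha> T)\<^sup>2 * F (rescaled_local_time X \<alpha> T \<omega>)))
             * indicator {\<omega>. supp (rescaled_local_time X \<alpha> T \<omega>) \<subseteq> cube R} \<omega> \<partial>M)
     \<le> ennreal (exp (- c * T / (\<alpha> T)\<^sup>2) * (exp (2 * real CARD('d) * N) * (T + 1) ^ (N + 1)))"
proof -
  interpret markov_chain M X srw_generator 0 by fact
  define B where "B = (lattice_cube (R * \<alpha> T) :: (int ^ 'd) set)"
  have B: "finite B" unfolding B_def using R a by (intro finite_lattice_cube) simp
  define \<nu> where "\<nu> \<omega> z = local_time X T \<omega> z / T" for \<omega> z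
  define D where "D \<omega> = (\<Sum>x\<in>B. \<Sum>y\<in>B. sqrt (\<nu> \<omega> x) * srw_generator x y * sqrt (\<nu> \<omega> y))" for \<omega>
  define S where "S = {\<omega>. \<forall>z. z \<notin> B \<longrightarrow> local_time X T \<omega> z = 0}"
  have ptw: "\<omega> \<in> S \<and> exp (T / (\<alpha> T)\<^sup>2 * F (rescaled_local_time X \<alpha> T \<omega>)) \<le> exp (- c * T / (\<alpha> T)\<^sup>2) * exp (- T * D \<omega>)"
    if \<omega>: "\<omega> \<in> space M" and supp: "supp (rescaled_local_time X \<alpha> T \<omega>) \<subseteq> cube R" for \<omega>
  proof -
    have L: "rescaled_local_time X \<alpha> T \<omega> = rescaled_density (\<alpha> T) (\<nu> \<omega>)"
      by (simp add: rescaled_local_time_eq_rescaled_density \<nu>_def[abs_def])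
    have nu0: "\<nu> \<omega> z = 0" if "z \<notin> B" for z
      using supp_rescaled_density_imp[OF a supp[unfolded L]] that unfolding B_def by blast
    then have lt0: "local_time X T \<omega> z = 0" if "z \<notin> B" for z
      using that T by (simp add: \<nu>_def)
    have "(\<Sum>z\<in>B. \<nu> \<omega> z) = 1"
      using sum_local_time[OF walk T \<omega> B lt0] T by (simp add: \<nu>_def flip: sum_divide_distrib)
    then have "\<nu> \<omega> \<in> lattice_prob_measures R (\<alpha> T)"
      using nu0 supp T by (auto simp: lattice_prob_measures_def B_def[symmetric] L \<nu>_def local_time_nonneg)
    then have "F (rescaled_local_time X \<alpha> T \<omega>)
        \<le> (\<alpha> T)\<^sup>2 * (1/2 * sum_edges (\<lambda>x y. (sqrt (\<nu> \<omega> x) - sqrt (\<nu> \<omega> y))\<^sup>2)) - c"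
      using F L by fastforce
    also have "\<dots> \<le> (\<alpha> T)\<^sup>2 * (- D \<omega>) - c"
      unfolding D_def using nu0
      by (intro diff_right_mono mult_left_mono sum_edges_le_dirichlet_form[OF B]) auto
    finally have "T / (\<alpha> T)\<^sup>2 * F (rescaled_local_time X \<alpha> T \<omega>) \<le> T / (\<alpha> T)\<^sup>2 * ((\<alpha> T)\<^sup>2 * (- D \<omega>) - c)"
      using T by (intro mult_left_mono) auto
    also have "\<dots> = - c * T / (\<alpha> T)\<^sup>2 + - T * D \<omega>" using a by (simp add: field_simps)
    finally show ?thesis using lt0 unfolding S_def by (simp flip: exp_add)
  qed
  have K: "(\<integral>\<^sup>+ \<omega>. ennreal (exp (- T * D \<omega>)) * indicator S \<omega> \<partial>M)
     \<le> ennreal (exp (2 * real CARD('d) * N) * (T + 1) ^ (N + 1))"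
    unfolding D_def S_def N_def B_def[symmetric] \<nu>_def
    by (rule exp_dirichlet_form_local_times_le[OF walk row_bounded_srw_generator _ B T])
      (simp add: srw_generator_def)
  have "(\<integral>\<^sup>+ \<omega>. ennreal (exp (T / (\<alpha> T)\<^sup>2 * F (rescaled_local_time X \<alpha> T \<omega>)))
             * indicator {\<omega>. supp (rescaled_local_time X \<alpha> T \<omega>) \<subseteq> cube R} \<omega> \<partial>M)
      \<le> (\<integral>\<^sup>+ \<omega>. ennreal (exp (- c * T / (\<alpha> T)\<^sup>2)) * (ennreal (exp (- T * D \<omega>)) * indicator S \<omega>) \<partial>M)"
    using ptw by (intro nn_integral_mono) (auto simp: indicator_def ennreal_leI simp flip: ennreal_mult)
  also have "\<dots> \<le> ennreal (exp (- c * T / (\<alpha> T)\<^sup>2)) * ennreal (exp (2 * real CARD('d) * N) * (T + 1) ^ (N + 1))"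
  proof -
    have [measurable]: "(\<lambda>\<omega>. local_time X T \<omega> z) \<in> borel_measurable M" for z
      unfolding local_time_def
      by (rule measurable_additive_functional[OF walk T, of "indicator {z}" 1]) (simp add: indicator_def)
    have "(\<lambda>\<omega>. ennreal (exp (- T * D \<omega>)) * (if \<forall>z. z \<notin> B \<longrightarrow> local_time X T \<omega> z = 0 then 1 else 0)) \<in> borel_measurable M"
      unfolding D_def \<nu>_def by measurable
    then have m: "(\<lambda>\<omega>. ennreal (exp (- T * D \<omega>)) * indicator S \<omega>) \<in> borel_measurable M"
      by (simp add: S_def indicator_def of_bool_def)
    show ?thesis unfolding nn_integral_cmult[OF m] by (intro mult_left_mono K) simp
  qed
  finally show ?thesis using T by (simp flip: ennreal_mult)
qed

text \<open>As the number of sites is \<open>O(\<alpha>\<^sup>d)\<close>, the expression is \<open>O(\<alpha>^(d + 2) ln T / T)\<close>, a constant multiple of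
  the power \<open>d + 2\<close> of the ratio that tends to 0 by the upper growth condition.\<close>

lemma lattice_entropy_negligible:
  fixes \<alpha> :: "real \<Rightarrow> real" and N :: "real \<Rightarrow> nat" and d :: nat
  assumes alpha_pos: "\<And>T. 0 < T \<Longrightarrow> 0 < \<alpha> T"
    and alpha_lower: "((\<lambda>T. 1 / \<alpha> T) \<longlongrightarrow> 0) at_top"
    and alpha_upper: "((\<lambda>T. \<alpha> T / (T / ln T) powr (1 / (real d + 2))) \<longlongrightarrow> 0) at_top"
    and R: "0 < R" and N: "\<And>T. 0 < T \<Longrightarrow> real (N T) \<le> (2 * (R * \<alpha> T) + 1) ^ d"
  shows "((\<lambda>T. (\<alpha> T)\<^sup>2 / T * (2 * real d * N T + (N T + 1) * ln (T + 1))) \<longlongrightarrow> 0) at_top"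
proof -
  define q where "q T = \<alpha> T / (T / ln T) powr (1 / (real d + 2))" for T
  define K where "K = (2 * R + 1) ^ d + 1"
  define C where "C = 2 * (2 * real d + 1) * K"
  have lim: "((\<lambda>T. C * q T ^ (d + 2)) \<longlongrightarrow> C * 0 ^ (d + 2)) at_top"
    using alpha_upper unfolding q_def by (intro tendsto_intros)
  have "eventually (\<lambda>T. 1 / \<alpha> T < 1) at_top" using order_tendstoD(2)[OF alpha_lower, of 1] by simp
  with eventually_ge_at_top[of 2]
  have bounds: "eventually (\<lambda>T. 0 \<le> (\<alpha> T)\<^sup>2 / T * (2 * real d * N T + (N T + 1) * ln (T + 1)) \<and>
     (\<alpha> T)\<^sup>2 / T * (2 * real d * N T + (N T + 1) * ln (T + 1)) \<le> C * q T ^ (d + 2)) at_top"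
  proof eventually_elim
    case (elim T)
    then have T: "2 \<le> T" and a: "0 < \<alpha> T" using alpha_pos[of T] by auto
    then have a1: "1 \<le> \<alpha> T" using elim by (simp add: divide_less_eq)
    have L1: "1 \<le> ln (T + 1)" using T exp_le by (subst ln_ge_iff) auto
    have L2: "ln (T + 1) \<le> 2 * ln T"
    proof -
      have "2 * T \<le> T * T" using T by (intro mult_right_mono) auto
      then have "T + 1 \<le> T ^ 2" using T by (simp only: power2_eq_square)
      then have "ln (T + 1) \<le> ln (T ^ 2)" using T by (subst ln_le_cancel_iff) auto
      then show ?thesis using T by (simp add: ln_realpow)
    qed
    have N1: "real (N T) + 1 \<le> K * \<alpha> T ^ d"
    proof -
      have "real (N T) \<le> (2 * (R * \<alpha> T) + 1) ^ d" using N T by simp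
      also have "\<dots> \<le> ((2 * R + 1) * \<alpha> T) ^ d"
        using a a1 R by (intro power_mono) (auto simp: algebra_simps)
      finally have "real (N T) \<le> (2 * R + 1) ^ d * \<alpha> T ^ d" by (simp add: power_mult_distrib)
      moreover have "1 \<le> \<alpha> T ^ d" using a1 by (rule one_le_power)
      ultimately show ?thesis by (simp add: K_def algebra_simps)
    qed
    have K0: "0 \<le> K" using R by (simp add: K_def)
    have "2 * real d * N T + (N T + 1) * ln (T + 1) \<le> (2 * real d * (N T + 1)) * ln (T + 1) + (N T + 1) * ln (T + 1)"
    proof -
      have "2 * real d * N T * 1 \<le> (2 * real d * (N T + 1)) * ln (T + 1)"
        using L1 by (intro mult_mono) auto
      then show ?thesis by simp
    qed
    also have "\<dots> = (2 * real d + 1) * ((real (N T) + 1) * ln (T + 1))" by (simp add: algebra_simps)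
    also have "\<dots> \<le> (2 * real d + 1) * ((K * \<alpha> T ^ d) * (2 * ln T))"
      using N1 L1 L2 K0 a by (intro mult_left_mono mult_mono) auto
    finally have "(\<alpha> T)\<^sup>2 / T * (2 * real d * N T + (N T + 1) * ln (T + 1))
       \<le> (\<alpha> T)\<^sup>2 / T * ((2 * real d + 1) * ((K * \<alpha> T ^ d) * (2 * ln T)))"
      using T by (intro mult_left_mono) auto
    also have "\<dots> = C * (\<alpha> T ^ (d + 2) / (T / ln T))"
      by (simp add: C_def power_add power2_eq_square)
    also have "\<alpha> T ^ (d + 2) / (T / ln T) = q T ^ (d + 2)"
    proof -
      have pos: "0 < T / ln T" using T by simp
      then have nz: "T / ln T \<noteq> 0" by linarith
      have "((T / ln T) powr (1 / (real d + 2))) ^ (d + 2)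
          = (T / ln T) powr (real (d + 2) * (1 / (real d + 2)))"
        by (rule powr_power[OF nz])
      also have "real (d + 2) * (1 / (real d + 2)) = 1" by simp
      finally have "((T / ln T) powr (1 / (real d + 2))) ^ (d + 2) = T / ln T"
        using pos by (simp only: powr_one)
      then show ?thesis by (simp add: q_def power_divide)
    qed
    finally show ?case using T L1 by auto
  qed
  show ?thesis
    by (rule tendsto_sandwich[where f = "\<lambda>_. 0" and h = "\<lambda>T. C * q T ^ (d + 2)"])
      (use bounds lim in \<open>auto elim: eventually_mono\<close>)
qed

theorem theorem3p7:
  fixes M :: "'w measure"
    and X :: "real \<Rightarrow> 'w \<Rightarrow> int ^ 'd::finite"
    and \<alpha> :: "real \<Rightarrow> real"
    and R :: real
    and F :: "(real ^ 'd \<Rightarrow> real) \<Rightarrow> real"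
  assumes walk: "simple_random_walk M X"
    and alpha_pos: "\<And>T. 0 < T \<Longrightarrow> 0 < \<alpha> T"
    and alpha_lower: "((\<lambda>T. 1 / \<alpha> T) \<longlongrightarrow> 0) at_top"
    and alpha_upper:
      "((\<lambda>T. \<alpha> T / (T / ln T) powr (1 / (real CARD('d) + 2))) \<longlongrightarrow> 0) at_top"
    and R_pos: "0 < R"
    and F_measurable: "F \<in> borel_measurable (densities_borel (cube R))"
    and liminf_bound:
      "Liminf at_top (\<lambda>T. INF \<mu>\<in>lattice_prob_measures R (\<alpha> T).
          ereal ((\<alpha> T)\<^sup>2 * (1/2 * sum_edges (\<lambda>x y. (sqrt (\<mu> x) - sqrt (\<mu> y))\<^sup>2))
                 - F (rescaled_density (\<alpha> T) \<mu>))) \<ge> chi R F"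
  shows "Limsup at_top (\<lambda>T. ereal ((\<alpha> T)\<^sup>2 / T) *
           log_ennreal (\<integral>\<^sup>+ \<omega>. ennreal (exp (T / (\<alpha> T)\<^sup>2 * F (rescaled_local_time X \<alpha> T \<omega>)))
             * indicator {\<omega>. supp (rescaled_local_time X \<alpha> T \<omega>) \<subseteq> cube R} \<omega> \<partial>M))
         \<le> - chi R F"
proof -
  define J where "J T = (\<integral>\<^sup>+ \<omega>. ennreal (exp (T / (\<alpha> T)\<^sup>2 * F (rescaled_local_time X \<alpha> T \<omega>)))
             * indicator {\<omega>. supp (rescaled_local_time X \<alpha> T \<omega>) \<subseteq> cube R} \<omega> \<partial>M)" for T
  define N where "N T = card (lattice_cube (R * \<alpha> T) :: (int ^ 'd) set)" for T
  define err where "err T = (\<alpha> T)\<^sup>2 / T * (2 * real CARD('d) * N T + (N T + 1) * ln (T + 1))" for T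
  define L where "L = Limsup at_top (\<lambda>T. ereal ((\<alpha> T)\<^sup>2 / T) * log_ennreal (J T))"
  have err: "(err \<longlongrightarrow> 0) at_top"
    unfolding err_def
  proof (rule lattice_entropy_negligible[OF alpha_pos alpha_lower alpha_upper R_pos])
    show "real (N T) \<le> (2 * (R * \<alpha> T) + 1) ^ CARD('d)" if "0 < T" for T
      unfolding N_def using R_pos alpha_pos[OF that] by (intro card_lattice_cube_le) simp
  qed
  have L_le: "L \<le> ereal (- c)" if c: "ereal c < chi R F" for c
  proof -
    have "eventually (\<lambda>T. ereal c < (INF \<mu>\<in>lattice_prob_measures R (\<alpha> T).
          ereal ((\<alpha> T)\<^sup>2 * (1/2 * sum_edges (\<lambda>x y. (sqrt (\<mu> x) - sqrt (\<mu> y))\<^sup>2))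
                 - F (rescaled_density (\<alpha> T) \<mu>)))) at_top"
      by (rule less_LiminfD[OF less_le_trans[OF c liminf_bound]])
    with eventually_gt_at_top[of 0]
    have "eventually (\<lambda>T. ereal ((\<alpha> T)\<^sup>2 / T) * log_ennreal (J T) \<le> ereal (- c + err T)) at_top"
    proof eventually_elim
      case (elim T)
      note T = elim(1) and a = alpha_pos[OF elim(1)]
      define b where "b = exp (- c * T / (\<alpha> T)\<^sup>2) * (exp (2 * real CARD('d) * N T) * (T + 1) ^ (N T + 1))"
      have b: "0 < b" using T by (simp add: b_def)
      have "c \<le> (\<alpha> T)\<^sup>2 * (1/2 * sum_edges (\<lambda>x y. (sqrt (\<mu> x) - sqrt (\<mu> y))\<^sup>2)) - F (rescaled_density (\<alpha> T) \<mu>)"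
        if "\<mu> \<in> lattice_prob_measures R (\<alpha> T)" for \<mu>
      proof -
        have "ereal c < ereal ((\<alpha> T)\<^sup>2 * (1/2 * sum_edges (\<lambda>x y. (sqrt (\<mu> x) - sqrt (\<mu> y))\<^sup>2)) - F (rescaled_density (\<alpha> T) \<mu>))"
          by (rule less_le_trans[OF elim(2) INF_lower[OF that]])
        then show ?thesis by (simp only: ereal_less(1) less_ereal.simps less_imp_le)
      qed
      then have "J T \<le> ennreal b"
        unfolding J_def b_def N_def by (rule exp_moment_rescaled_local_times_le[where \<alpha> = \<alpha>, OF walk T a R_pos])
      then have "log_ennreal (J T) \<le> ereal (ln b)" using b by (rule log_ennreal_le)
      then have "ereal ((\<alpha> T)\<^sup>2 / T) * log_ennreal (J T) \<le> ereal ((\<alpha> T)\<^sup>2 / T) * ereal (ln b)"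
        using T by (intro ereal_mult_left_mono) auto
      also have "\<dots> = ereal (- c + err T)"
      proof -
        have "ln b = - c * T / (\<alpha> T)\<^sup>2 + (2 * real CARD('d) * N T + (N T + 1) * ln (T + 1))"
          using T unfolding b_def by (simp add: ln_mult ln_realpow del: power_Suc)
        then have "(\<alpha> T)\<^sup>2 / T * ln b = - c + err T"
          using T a unfolding err_def by (simp only: distrib_left) simp
        then show ?thesis by simp
      qed
      finally show ?case .
    qed
    then have "L \<le> Limsup at_top (\<lambda>T. ereal (- c + err T))"
      unfolding L_def by (rule Limsup_mono)
    also have "\<dots> = ereal (- c + 0)"
      by (intro lim_imp_Limsup trivial_limit_at_top_linorder tendsto_intros err)
    finally show ?thesis by simp
  qed
  \<comment> \<open>Approximating \<open>\<chi>\<close> by real \<open>c\<close> from below treats finite and infinite \<open>\<chi>\<close> alike.\<close>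
  have "chi R F \<le> - L"
  proof (rule ccontr)
    assume "\<not> chi R F \<le> - L"
    then have "- L < chi R F" by (simp only: not_le)
    then obtain c where c: "- L < ereal c" "ereal c < chi R F"
      using ereal_dense2 by blast
    have "- ereal (- c) \<le> - L" using L_le[OF c(2)] by (simp only: ereal_minus_le_minus)
    then show False using c(1) by simp
  qed
  then have "- (- L) \<le> - chi R F" by (simp only: ereal_minus_le_minus)
  then show ?thesis by (simp only: ereal_uminus_uminus L_def J_def)
qed

end
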